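(* Let $\{A_i\}_{i\in I}$ be a finite family of invertible positive $2\times 2$ matrices and $(w_i)_{i\in I}$ a probability vector with all $w_i>0$; let $\lambda$ be the top Lyapunov exponent, and let $T$ and $\boldsymbol v$ be the infinite matrix and vector associated with $\{A_i\}_{i\in I}$ and $(w_i)_{i\in I}$ (defined in the context). Then for any $\varepsilon>0$ there are natural numbers $N=N(\varepsilon)$ and $M=M(\varepsilon)$, with $N=O(\log(1/\varepsilon))$ and $M=O(\log(N/\varepsilon))$ as $\varepsilon\to0$ (implied constants depending only on the family and the weights), such that $$\left|\lambda-\sum_{n=0}^{N-1}\big({T_M}^n\boldsymbol v^{(M)}\big)_0\right|<\varepsilon,$$ where $T_M$ is the upper-left $M\times M$ submatrix of $T$ (indices $0,\dots,M-1$) and $\boldsymbol v^{(M)}$ is the vector of the first $M$ components of $\boldsymbol v$ (indices $0,\dots,M-1$). In particular, $\lambda$ can be approximated to within error $\varepsilon$ with $O\big((\log(1/\varepsilon))^3\big)$ arithmetic operations.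
   Context: $\mathbb N=\{1,2,\dots\}$, $\mathbb N_0=\mathbb N\cup\{0\}$. A matrix is positive if all its entries are $>0$. Powers use the convention $0^0=1$. An arithmetic operation is an addition, subtraction, multiplication or division of real numbers; the numbers $w_i$, $f_i(0)$, $f_i^{\top}(0)$, $f_i'(0)$ and $\boldsymbol v_0$ (defined below) are regarded as given. Lyapunov exponent: with $\mu$ the Bernoulli measure on $I^{\mathbb N}$ with weights $(w_i)$, $\lambda$ is the $\mu$-a.e. constant value of $\lim_{n\to\infty}\frac1n\log\|A_{i_n}\cdots A_{i_1}\|$ (which exists and is independent of the norm, by Furstenberg--Kesten). Möbius maps: $\mathrm{PGL}_2(\mathbb R)=\mathrm{GL}_2(\mathbb R)/\sim$, where $A\sim B$ iff $A=tB$ for some $t\in\mathbb R\setminus\{0\}$. The class $[M]$ of $M=\begin{pmatrix}\alpha&\beta\\ \gamma&\delta\end{pmatrix}$ is identified with the Möbius transformation $x\mapsto\frac{\alpha x+\beta}{\gamma x+\delta}$ of the Riemann sphere. For $f=[M]$ put $f^{\top}=[M^{\top}]$. Define $$F\begin{pmatrix}p&q\\ r&s\end{pmatrix}=\frac12\begin{pmatrix}p-q-r+s&p+q-r-s\\ p-q+r-s&p+q+r+s\end{pmatrix}$$ and $f_i=[F(A_i)]$. The vector $\boldsymbol v$: for $x,c\in\mathbb C$, $|x|\le1$, let $v(x;c)$ be the sequence indexed by $\mathbb N_0$ with $(v(x;c))_0=c$ and $(v(x;c))_n=-\frac{(-x)^n}{n}$ for $n\ge1$. Then $\boldsymbol v=\sum_{i\in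 I}w_i\,v\big(f_i(0);\tfrac12\log(\det F(A_i)/f_i'(0))\big)$ (the argument of the logarithm is positive). The infinite matrix $T=(b_{k,n})_{k,n\in\mathbb N_0}$: $b_{k,0}=0$ for $k\ge0$; $b_{0,n}=\sum_{i}w_i(f_i^{\top}(0))^n$ for $n\ge1$; and for $k,n\ge1$ $$b_{k,n}=\sum_{i\in I}w_i\sum_{\ell=1}^{\min\{k,n\}}\binom n\ell\binom{k-1}{\ell-1}(f_i^{\top}(0))^{n-\ell}(-f_i(0))^{k-\ell}(f_i'(0))^{\ell}.$$ *)

theory Defs
  imports "HOL-Probability.Probability" "HOL-Library.Landau_Symbols" "Jordan_Normal_Form.Matrix"
begin

(* "$" keeps its HOL-Analysis meaning (vec_nth); entries of the vectors of variable dimension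
   from Jordan_Normal_Form are written with vec_index. *)
no_notation vec_index (infixl \<open>$\<close> 100)

definition positive_matrix :: "real^2^2 \<Rightarrow> bool" where
  "positive_matrix A \<longleftrightarrow> (\<forall>i j. 0 < A $ i $ j)"

section \<open>The Lyapunov exponent\<close>

definition bernoulli_measure :: "('i \<Rightarrow> real) \<Rightarrow> (nat \<Rightarrow> 'i) measure" where
  "bernoulli_measure w = PiM UNIV (\<lambda>_. point_measure UNIV (\<lambda>i. ennreal (w i)))"

(* matrix_product A x n = A (x (n-1)) ** ... ** A (x 0): sequences are indexed from 0 here,
   so x k is the index called i_(k+1) in the usual notation. *)
primrec matrix_product :: "('i \<Rightarrow> real^2^2) \<Rightarrow> (nat \<Rightarrow> 'i) \<Rightarrow> nat \<Rightarrow> real^2^2" where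
  "matrix_product A x 0 = Finite_Cartesian_Product.mat 1"
| "matrix_product A x (Suc n) = A (x n) ** matrix_product A x n"

(* The norm on the type of 2 x 2 matrices is the Euclidean (Frobenius) norm; the limit does not
   depend on this choice. *)
definition lyapunov_exponent :: "('i \<Rightarrow> real^2^2) \<Rightarrow> ('i \<Rightarrow> real) \<Rightarrow> real" where
  "lyapunov_exponent A w =
     (THE l. AE x in bernoulli_measure w.
        (\<lambda>n. ln (norm (matrix_product A x n)) / real n) \<longlonglongrightarrow> l)"

section \<open>The Moebius maps\<close>

definition F :: "real^2^2 \<Rightarrow> real^2^2" where
  "F A = (let p = A $ 1 $ 1; q = A $ 1 $ 2; r = A $ 2 $ 1; s = A $ 2 $ 2 in
     (1/2) *\<^sub>R vector [vector [p - q - r + s, p + q - r - s],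
                     vector [p - q + r - s, p + q + r + s]])"

(* The class of M in PGL_2(R), evaluated at real points that are not poles.  Only the point 0 is
   ever used, and for a positive matrix A neither F A nor its transpose has a pole there, the lower
   right entry being positive. *)
definition moebius :: "real^2^2 \<Rightarrow> real \<Rightarrow> real" where
  "moebius M x = (M $ 1 $ 1 * x + M $ 1 $ 2) / (M $ 2 $ 1 * x + M $ 2 $ 2)"

definition f_0 :: "real^2^2 \<Rightarrow> real" where
  "f_0 A = moebius (F A) 0"

definition f_transpose_0 :: "real^2^2 \<Rightarrow> real" where
  "f_transpose_0 A = moebius (Finite_Cartesian_Product.transpose (F A)) 0"

definition f_deriv_0 :: "real^2^2 \<Rightarrow> real" where
  "f_deriv_0 A = deriv (moebius (F A)) 0"

section \<open>The infinite vector and the infinite matrix\<close>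

definition v_seq :: "real \<Rightarrow> real \<Rightarrow> nat \<Rightarrow> real" where
  "v_seq x c n = (if n = 0 then c else - ((- x) ^ n / real n))"

definition v_vec :: "('i::finite \<Rightarrow> real^2^2) \<Rightarrow> ('i \<Rightarrow> real) \<Rightarrow> nat \<Rightarrow> real" where
  "v_vec A w n =
     (\<Sum>i\<in>UNIV. w i * v_seq (f_0 (A i)) (1/2 * ln (det (F (A i)) / f_deriv_0 (A i))) n)"

definition T_entry :: "('i::finite \<Rightarrow> real^2^2) \<Rightarrow> ('i \<Rightarrow> real) \<Rightarrow> nat \<Rightarrow> nat \<Rightarrow> real" where
  "T_entry A w k n =
     (if n = 0 then 0
      else if k = 0 then (\<Sum>i\<in>UNIV. w i * f_transpose_0 (A i) ^ n)
      else (\<Sum>i\<in>UNIV. w i *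
        (\<Sum>l = 1..min k n. real (n choose l) * real ((k - 1) choose (l - 1)) *
           f_transpose_0 (A i) ^ (n - l) * (- f_0 (A i)) ^ (k - l) * f_deriv_0 (A i) ^ l)))"

definition T_trunc :: "('i::finite \<Rightarrow> real^2^2) \<Rightarrow> ('i \<Rightarrow> real) \<Rightarrow> nat \<Rightarrow> real Matrix.mat" where
  "T_trunc A w M = Matrix.mat M M (\<lambda>(k, n). T_entry A w k n)"

definition v_trunc :: "('i::finite \<Rightarrow> real^2^2) \<Rightarrow> ('i \<Rightarrow> real) \<Rightarrow> nat \<Rightarrow> real Matrix.vec" where
  "v_trunc A w M = Matrix.vec M (v_vec A w)"

definition lyapunov_approx ::
  "('i::finite \<Rightarrow> real^2^2) \<Rightarrow> ('i \<Rightarrow> real) \<Rightarrow> nat \<Rightarrow> nat \<Rightarrow> real" where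
  "lyapunov_approx A w N M =
     (\<Sum>n<N. vec_index ((T_trunc A w M ^\<^sub>m n) *\<^sub>v v_trunc A w M) 0)"

section \<open>Counting arithmetic operations\<close>

(* Straight-line programs over the reals: every instruction is one arithmetic operation on given
   numbers and on results of earlier instructions (Reg j is the result of instruction j, counted
   from 0), so the length of a program is its number of operations.  There are no constants
   available beyond the given numbers.  An operation count is meaningful only if the programs are
   chosen before the matrices and weights: a program tailored to one real number could simply
   produce its leading binary digits. *)
datatype 'i given = Weight 'i | F_0 'i | F_transpose_0 'i | F_deriv_0 'i | V_0

datatype 'i operand = Given "'i given" | Reg nat

datatype 'i instruction =
    Add "'i operand" "'i operand"
  | Sub "'i operand" "'i operand"
  | Mul "'i operand" "'i operand"
  | Div "'i operand" "'i operand"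

type_synonym 'i program = "'i instruction list"

primrec given_value ::
  "('i::finite \<Rightarrow> real^2^2) \<Rightarrow> ('i \<Rightarrow> real) \<Rightarrow> 'i given \<Rightarrow> real" where
  "given_value A w (Weight i) = w i"
| "given_value A w (F_0 i) = f_0 (A i)"
| "given_value A w (F_transpose_0 i) = f_transpose_0 (A i)"
| "given_value A w (F_deriv_0 i) = f_deriv_0 (A i)"
| "given_value A w V_0 = v_vec A w 0"

primrec operand_value :: "('i given \<Rightarrow> real) \<Rightarrow> real list \<Rightarrow> 'i operand \<Rightarrow> real option" where
  "operand_value g rs (Given a) = Some (g a)"
| "operand_value g rs (Reg j) = (if j < length rs then Some (rs ! j) else None)"

(* A division by zero makes a program fail, so that x / 0 = 0 cannot serve as a zero test. *)
primrec instruction_value ::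
  "('i given \<Rightarrow> real) \<Rightarrow> real list \<Rightarrow> 'i instruction \<Rightarrow> real option" where
  "instruction_value g rs (Add a b) =
     Option.bind (operand_value g rs a) (\<lambda>x. Option.bind (operand_value g rs b) (\<lambda>y. Some (x + y)))"
| "instruction_value g rs (Sub a b) =
     Option.bind (operand_value g rs a) (\<lambda>x. Option.bind (operand_value g rs b) (\<lambda>y. Some (x - y)))"
| "instruction_value g rs (Mul a b) =
     Option.bind (operand_value g rs a) (\<lambda>x. Option.bind (operand_value g rs b) (\<lambda>y. Some (x * y)))"
| "instruction_value g rs (Div a b) =
     Option.bind (operand_value g rs a) (\<lambda>x. Option.bind (operand_value g rs b)
       (\<lambda>y. if y = 0 then None else Some (x / y)))"

fun run :: "('i given \<Rightarrow> real) \<Rightarrow> real list \<Rightarrow> 'i program \<Rightarrow> real list option" where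
  "run g rs [] = Some rs"
| "run g rs (c # cs) = Option.bind (instruction_value g rs c) (\<lambda>z. run g (rs @ [z]) cs)"

(* The output of a program is the result of its last instruction. *)
definition computes :: "('i given \<Rightarrow> real) \<Rightarrow> 'i program \<Rightarrow> real \<Rightarrow> bool" where
  "computes g p y \<longleftrightarrow> (\<exists>rs. run g [] p = Some rs \<and> rs \<noteq> [] \<and> last rs = y)"

definition operation_count :: "'i program \<Rightarrow> nat" where
  "operation_count p = length p"

end

(* In the coordinate x = (a - b)/(a + b) on directions of vectors (a, b), the transposed matrices act
   by g_i(x) = c_i + t_i x / (1 + b_i x) with c_i = f_i^T(0), b_i = f_i(0), t_i = f_i'(0), which map a
   disc of some radius R > 1 into the unit disc.  The vector v lists the Taylor coefficients of
   Phi(x) = sum_i w_i ln (lower coordinate of F(A_i)^T (x, 1)), and T represents h |-> L h - h(0) with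
   L h = sum_i w_i h(g_i).  As L fixes constants, the sum over n < N of (T^n Phi)(0) telescopes to
   (L^(N-1) Phi)(0), the N-th increment of the expected logarithm of the entry sum of a random
   product.  Contraction of the g_i in the Hilbert metric makes these increments converge
   exponentially fast; an exponential moment bound and Borel-Cantelli identify their limit with the
   Lyapunov exponent.  By the Cauchy estimate on |x| = R the entries in row k of T are at most R^(-k),
   so truncation at M costs at most R^(-M) times a factor exponential in N, which is absorbed by
   M of order log(1/epsilon).  The entries of T satisfy a five-operation recursion, so T_M costs O(M^2)
   and the iterates O(N M^2) operations. *)

theory Submission
  imports Defs "HOL-Complex_Analysis.Laurent_Convergence"
begin

section \<open>Contraction of positive matrices\<close>

text \<open>\<open>F\<close> is conjugation by the rotation through 45 degrees, so it commutes with
  transposition and keeps determinants; it turns the positive quadrant into the cone over (-1, 1)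
  and positivity into a disc mapped into its own interior. Transposing all matrices leaves the
  exponent unchanged, because a reversed word of independent letters has the same law, and it is the
  transposed maps whose expansion at 0 gives the entries of \<open>T\<close>.

  The two sources of error need different tools. Exponential decay in N is shown for the exact
  functions only, by real projective contraction. No contraction is shown for the truncated
  matrices: their iterates are merely bounded by powers of a constant above 1. With N logarithmic in
  1/epsilon such a power is polynomial in 1/epsilon.

  Convergence of the means alone would not determine the exponent, which is defined through an
  almost sure limit; hence the concentration argument. The programs are fixed before the family is
  known and have no literals, so even 0, 1 and the denominators k must be produced from the weights,
  and every division must be safe for all admissible inputs.\<close>

no_notation scalar_prod (infix "\<bullet>" 70)
no_notation fps_nth (infixl "$" 75)

abbreviation tr :: "real^'n^'m \<Rightarrow> real^'m^'n" where
  "tr \<equiv> Finite_Cartesian_Product.transpose"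

text \<open>In the variable $y = \ln a$ the derivative of the left-hand function is bounded by the constant.\<close>

lemma moebius_ln_contraction:
  fixes p q r s a b :: real
  assumes "p > 0" "q > 0" "r > 0" "s > 0" "a > 0" "b > 0"
  shows "\<bar>ln ((p * a + q) / (r * a + s)) - ln ((p * b + q) / (r * b + s))\<bar>
    \<le> \<bar>p * s - q * r\<bar> / (p * s + q * r) * \<bar>ln a - ln b\<bar>"
proof -
  define G where "G y = ln (p * exp y + q) - ln (r * exp y + s)" for y
  define G' where "G' y = exp y * (p * s - q * r) / ((p * exp y + q) * (r * exp y + s))" for y
  have pos: "p * exp y + q > 0" "r * exp y + s > 0" for y
    using assms by (simp_all add: add_pos_pos)
  have der: "(G has_field_derivative G' y) (at y within UNIV)" for y
    unfolding G_def G'_def using pos[of y]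
    by (auto intro!: derivative_eq_intros simp: divide_simps) (simp add: algebra_simps)
  have bound: "norm (G' y) \<le> \<bar>p * s - q * r\<bar> / (p * s + q * r)" for y
  proof -
    \<comment> \<open>Only the cross terms of the product are kept. Balancing the two dropped terms
      would give Birkhoff's sharp constant; any constant below 1 is enough.\<close>
    have "exp y * (p * s + q * r) \<le> (p * exp y + q) * (r * exp y + s)"
      using assms by (simp add: algebra_simps)
    then have "exp y * (p * s + q * r) * \<bar>p * s - q * r\<bar>
        \<le> (p * exp y + q) * (r * exp y + s) * \<bar>p * s - q * r\<bar>"
      by (rule mult_right_mono) simp
    then show ?thesis
      unfolding G'_def using assms pos[of y]
      by (simp add: abs_mult abs_divide divide_le_eq pos_le_divide_eq add_pos_pos mult.commute
          mult.left_commute mult.assoc)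
  qed
  have "norm (G (ln a) - G (ln b)) \<le> \<bar>p * s - q * r\<bar> / (p * s + q * r) * norm (ln a - ln b)"
    by (rule field_differentiable_bound[OF convex_UNIV der bound]) auto
  moreover have "G (ln c) = ln ((p * c + q) / (r * c + s))" if "c > 0" for c
  proof -
    have "p * c + q > 0" "r * c + s > 0"
      using that assms by (simp_all add: add_pos_pos)
    then show ?thesis
      using that by (simp add: G_def ln_div)
  qed
  ultimately show ?thesis
    using assms by simp
qed

lemma geometric_limit:
  fixes a :: "nat \<Rightarrow> real"
  assumes "\<And>n. \<bar>a (Suc n) - a n\<bar> \<le> D * \<theta> ^ n" "0 < \<theta>" "\<theta> < 1"
  obtains l where "\<And>n. \<bar>a n - l\<bar> \<le> D / (1 - \<theta>) * \<theta> ^ n"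
proof -
  define d where "d n = a (Suc n) - a n" for n
  have sg: "summable (\<lambda>k. D * \<theta> ^ k)"
    using assms by (intro summable_mult summable_geometric) auto
  have "summable d"
    by (rule summable_comparison_test'[OF sg, of 0]) (use assms(1) in \<open>simp add: d_def\<close>)
  then have "convergent (\<lambda>n. \<Sum>k<n. d k)"
    by (simp add: summable_iff_convergent)
  then obtain L where L: "(\<lambda>n. \<Sum>k<n. d k) \<longlonglongrightarrow> L"
    by (auto simp: convergent_def)
  have "a = (\<lambda>n. (\<Sum>k<n. d k) + a 0)"
    unfolding d_def sum_lessThan_telescope by simp
  then have lim: "a \<longlonglongrightarrow> L + a 0"
    using tendsto_add[OF L tendsto_const[of "a 0"]] by metis
  have "\<bar>a n - (L + a 0)\<bar> \<le> D / (1 - \<theta>) * \<theta> ^ n" for n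
  proof -
    have "(\<lambda>k. d (k + n)) sums (L + a 0 - a n)"
      using telescope_sums[OF LIMSEQ_ignore_initial_segment[OF lim, of n]] by (simp add: d_def)
    then have eq: "L + a 0 - a n = (\<Sum>k. d (k + n))"
      by (simp add: sums_iff)
    have s: "(\<lambda>k. D * \<theta> ^ n * \<theta> ^ k) sums (D * \<theta> ^ n * (1 / (1 - \<theta>)))"
      using assms by (intro sums_mult geometric_sums) auto
    have "norm (\<Sum>k. d (k + n)) \<le> (\<Sum>k. D * \<theta> ^ n * \<theta> ^ k)"
    proof (rule norm_suminf_le)
      show "norm (d (k + n)) \<le> D * \<theta> ^ n * \<theta> ^ k" for k
        using assms(1)[of "k + n"] by (simp add: d_def power_add mult_ac)
    qed (use s in \<open>simp add: sums_iff\<close>)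
    then show ?thesis
      using s unfolding eq[symmetric] by (simp add: sums_iff abs_minus_commute)
  qed
  then show ?thesis
    using that by blast
qed

section \<open>Mean logarithms of random products and their increments\<close>

definition positive_vector :: "real^'n \<Rightarrow> bool" where
  "positive_vector v \<longleftrightarrow> (\<forall>k. 0 < v $ k)"

text \<open>Logarithmic coordinate on directions: the distance between two values is the Hilbert
  distance of the positive vectors.\<close>

definition log_ratio :: "real^2 \<Rightarrow> real" where
  "log_ratio v = ln (v $ 1 / v $ 2)"

text \<open>The expectation of $\ln \langle u, A_{i_n} \cdots A_{i_1} v\rangle$ for independent indices.\<close>

primrec mean_log ::
  "('i::finite \<Rightarrow> real^2^2) \<Rightarrow> ('i \<Rightarrow> real) \<Rightarrow> nat \<Rightarrow> real^2 \<Rightarrow> real^2 \<Rightarrow> real" where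
  "mean_log A w 0 u v = ln (u \<bullet> v)"
| "mean_log A w (Suc n) u v = (\<Sum>i\<in>UNIV. w i * mean_log A w n u (A i *v v))"

text \<open>For positive vectors the scale of \<open>v\<close> cancels in the difference, so this
  depends on the direction of \<open>v\<close> only and projective contraction applies to
  it.\<close>

definition mean_incr ::
  "('i::finite \<Rightarrow> real^2^2) \<Rightarrow> ('i \<Rightarrow> real) \<Rightarrow> nat \<Rightarrow> real^2 \<Rightarrow> real^2 \<Rightarrow> real" where
  "mean_incr A w n u v = mean_log A w (Suc n) u v - mean_log A w n u v"

lemma mean_incr_Suc:
  "mean_incr A w (Suc n) u v = (\<Sum>i\<in>UNIV. w i * mean_incr A w n u (A i *v v))"
  by (simp add: mean_incr_def sum_subtractf right_diff_distrib)

text \<open>The recursion of \<open>mean_log\<close> peels off the letter next to \<open>v\<close>.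
  By independence the letter at the other end may be averaged instead; it acts on \<open>u\<close>
  by its transpose.\<close>

lemma mean_log_Suc_left:
  "mean_log A w (Suc n) u v = (\<Sum>i\<in>UNIV. w i * mean_log A w n (tr (A i) *v u) v)"
proof (induction n arbitrary: v)
  case 0
  show ?case
    by (simp add: inner_vec_def sum_2 matrix_vector_mult_def transpose_def algebra_simps)
next
  case (Suc n)
  have "mean_log A w (Suc (Suc n)) u v
      = (\<Sum>i\<in>UNIV. w i * (\<Sum>j\<in>UNIV. w j * mean_log A w n (tr (A j) *v u) (A i *v v)))"
    using Suc.IH by simp
  also have "\<dots> = (\<Sum>j\<in>UNIV. \<Sum>i\<in>UNIV. w i * (w j * mean_log A w n (tr (A j) *v u) (A i *v v)))"
    unfolding sum_distrib_left by (rule sum.swap)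
  also have "\<dots> = (\<Sum>j\<in>UNIV. w j * mean_log A w (Suc n) (tr (A j) *v u) v)"
    by (simp add: sum_distrib_left mult_ac)
  finally show ?case .
qed

text \<open>Transposition reverses the product, and a reversed word has the same weight. This
  connects the family with the transposed maps from which \<open>T\<close> is built.\<close>

lemma mean_log_transpose:
  "mean_log (\<lambda>i. tr (A i)) w n u v = mean_log A w n v u"
proof (induction n arbitrary: v)
  case (Suc n)
  then show ?case
    unfolding mean_log_Suc_left[of A] by simp
qed (simp add: inner_commute)

lemma mean_incr_transpose:
  "mean_incr (\<lambda>i. tr (A i)) w n u v = mean_incr A w n v u"
  by (simp only: mean_incr_def mean_log_transpose)

locale positive_family =
  fixes A :: "'i::finite \<Rightarrow> real^2^2" and w :: "'i \<Rightarrow> real"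
  assumes A_pos: "\<And>i. positive_matrix (A i)"
    and w_pos: "\<And>i. 0 < w i"
    and w_sum: "(\<Sum>i\<in>UNIV. w i) = 1"
begin

lemma entry_pos: "0 < A i $ k $ l"
  using A_pos[of i] by (simp add: positive_matrix_def)

lemma transpose_positive_family: "positive_family (\<lambda>i. tr (A i)) w"
  using A_pos w_pos w_sum by unfold_locales (auto simp: positive_matrix_def transpose_def)

lemma mean_le:
  assumes "\<And>i. f i \<le> c" shows "(\<Sum>i\<in>UNIV. w i * f i) \<le> c"
proof -
  have "(\<Sum>i\<in>UNIV. w i * f i) \<le> (\<Sum>i\<in>UNIV. w i * c)"
    using assms w_pos by (intro sum_mono mult_left_mono) (auto simp: less_imp_le)
  then show ?thesis by (simp add: w_sum flip: sum_distrib_right)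
qed

lemma mean_const: "(\<Sum>i\<in>UNIV. w i * c) = c"
  by (simp add: w_sum flip: sum_distrib_right)

lemma mean_abs_diff_le:
  assumes "\<And>i. \<bar>f i - g i\<bar> \<le> c"
  shows "\<bar>(\<Sum>i\<in>UNIV. w i * f i) - (\<Sum>i\<in>UNIV. w i * g i)\<bar> \<le> c"
proof -
  have "\<bar>\<Sum>i\<in>UNIV. w i * (f i - g i)\<bar> \<le> (\<Sum>i\<in>UNIV. \<bar>w i * (f i - g i)\<bar>)"
    by (rule sum_abs)
  also have "\<dots> = (\<Sum>i\<in>UNIV. w i * \<bar>f i - g i\<bar>)"
    using w_pos by (simp add: abs_mult less_imp_le)
  also have "\<dots> \<le> c"
    by (rule mean_le) (rule assms)
  finally show ?thesis
    by (simp add: right_diff_distrib sum_subtractf)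
qed

lemma positive_vector_mult: "positive_vector v \<Longrightarrow> positive_vector (A i *v v)"
  using entry_pos[of i]
  by (auto simp: positive_vector_def matrix_vector_mult_def sum_2 intro!: add_pos_pos)

lemma entries_bounded:
  obtains m where "m > 1" "\<And>i k l. A i $ k $ l \<le> m" "\<And>i k l. 1 / m \<le> A i $ k $ l"
proof -
  define E where "E = (\<lambda>(i, k, l). A i $ k $ l + 1 / A i $ k $ l)"
  define m where "m = 1 + (\<Sum>x\<in>UNIV. E x)"
  have E_pos: "E x > 0" for x
    using entry_pos by (auto simp: E_def split: prod.split intro!: add_pos_pos)
  have le: "E x < m" for x
    using member_le_sum[of x UNIV E] E_pos by (simp add: m_def less_imp_le)
  have m1: "m > 1"
    using E_pos by (simp add: m_def sum_pos)
  have *: "A i $ k $ l \<le> m \<and> 1 / m \<le> A i $ k $ l" for i k l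
  proof -
    have "A i $ k $ l + 1 / A i $ k $ l < m"
      using le[of "(i, k, l)"] by (simp add: E_def)
    moreover have "1 / A i $ k $ l > 0" "A i $ k $ l > 0"
      using entry_pos[of i k l] by auto
    ultimately have "A i $ k $ l < m" "1 / A i $ k $ l < m" by linarith+
    then show ?thesis
      using entry_pos[of i k l] m1 by (auto simp: field_simps)
  qed
  show ?thesis
    by (rule that[OF m1]) (use * in auto)
qed

text \<open>Positive matrices preserve the componentwise order, and the scalar survives every
  multiplication until the logarithm turns it into a summand. Applied to two different letters it
  bounds oscillation; applied to multiples of one vector it gives homogeneity.\<close>

lemma mean_log_mono_scale:
  assumes "positive_vector u" "positive_vector v" "positive_vector v'" "0 < c"
    and "\<And>k. v $ k \<le> c * v' $ k"
  shows "mean_log A w n u v \<le> mean_log A w n u v' + ln c"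
  using assms
proof (induction n arbitrary: v v')
  case 0
  then have "u \<bullet> v > 0" "u \<bullet> v' > 0"
    by (auto simp: inner_vec_def sum_2 positive_vector_def intro!: add_pos_pos)
  moreover have "u \<bullet> v \<le> u \<bullet> (c *\<^sub>R v')"
    unfolding inner_vec_def using 0
    by (intro sum_mono) (auto simp: positive_vector_def intro!: mult_left_mono less_imp_le)
  ultimately have "ln (u \<bullet> v) \<le> ln (c * (u \<bullet> v'))"
    using 0(4) by (intro ln_mono) simp_all
  then show ?case
    using \<open>0 < c\<close> \<open>u \<bullet> v' > 0\<close> by (simp add: ln_mult add.commute)
next
  case (Suc n)
  have le: "(A i *v v) $ k \<le> c * (A i *v v') $ k" for i k
  proof -
    have "(A i *v v) $ k \<le> (A i *v (c *\<^sub>R v')) $ k"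
      unfolding matrix_vector_mult_def using Suc.prems(5) entry_pos[of i k]
      by (auto intro!: sum_mono mult_left_mono simp: less_imp_le)
    then show ?thesis
      by (simp add: matrix_vector_mult_scaleR)
  qed
  have "mean_log A w (Suc n) u v \<le> (\<Sum>i\<in>UNIV. w i * (mean_log A w n u (A i *v v') + ln c))"
    unfolding mean_log.simps
    using Suc.prems le w_pos
    by (intro sum_mono mult_left_mono Suc.IH positive_vector_mult) (auto simp: less_imp_le)
  then show ?case
    by (simp add: distrib_left sum.distrib mean_const)
qed

text \<open>Any two matrices of the family are entrywise comparable up to the factor
  \<open>m\<^sup>2\<close>. The bound is uniform in n, as needed for the bounded differences in the
  concentration argument.\<close>

lemma mean_log_oscillation:
  obtains B where "B > 0"
    "\<And>n u v i j. positive_vector u \<Longrightarrow> positive_vector v \<Longrightarrow>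
       \<bar>mean_log A w n u (A i *v v) - mean_log A w n u (A j *v v)\<bar> \<le> B"
proof -
  obtain m where m: "m > 1" "\<And>i k l. A i $ k $ l \<le> m" "\<And>i k l. 1 / m \<le> A i $ k $ l"
    using entries_bounded by blast
  have one: "mean_log A w n u (A i *v v) \<le> mean_log A w n u (A j *v v) + ln (m\<^sup>2)"
    if "positive_vector u" "positive_vector v" for n u v i j
  proof (rule mean_log_mono_scale)
    fix k
    have v: "0 < v $ 1" "0 < v $ 2" using that by (auto simp: positive_vector_def)
    have "A i $ k $ l \<le> m\<^sup>2 * A j $ k $ l" for l
    proof -
      have "1 \<le> m * A j $ k $ l"
        using m(1) m(3)[of j k l] by (simp add: field_simps)
      then have "m \<le> m * (m * A j $ k $ l)"
        using m(1) by simp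
      then show ?thesis
        using m(2)[of i k l] by (simp add: power2_eq_square mult.assoc)
    qed
    then have "A i $ k $ 1 * v $ 1 + A i $ k $ 2 * v $ 2
        \<le> (m\<^sup>2 * A j $ k $ 1) * v $ 1 + (m\<^sup>2 * A j $ k $ 2) * v $ 2"
      using v by (intro add_mono mult_right_mono) (auto simp: less_imp_le)
    then show "(A i *v v) $ k \<le> m\<^sup>2 * (A j *v v) $ k"
      by (simp add: matrix_vector_mult_def sum_2 algebra_simps)
  qed (use that m in \<open>auto intro: positive_vector_mult\<close>)
  show ?thesis
  proof (rule that)
    show "ln (m\<^sup>2) > 0" using m(1) by (simp add: ln_gt_zero)
    show "\<bar>mean_log A w n u (A i *v v) - mean_log A w n u (A j *v v)\<bar> \<le> ln (m\<^sup>2)"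
      if "positive_vector u" "positive_vector v" for n u v i j
      using one[OF that, of n i j] one[OF that, of n j i] by linarith
  qed
qed

lemma log_ratio_contraction:
  obtains \<theta> where "0 < \<theta>" "\<theta> < 1"
    "\<And>i u v. positive_vector u \<Longrightarrow> positive_vector v \<Longrightarrow>
       \<bar>log_ratio (A i *v u) - log_ratio (A i *v v)\<bar> \<le> \<theta> * \<bar>log_ratio u - log_ratio v\<bar>"
proof -
  define \<tau> where "\<tau> i = \<bar>A i $ 1 $ 1 * A i $ 2 $ 2 - A i $ 1 $ 2 * A i $ 2 $ 1\<bar> /
      (A i $ 1 $ 1 * A i $ 2 $ 2 + A i $ 1 $ 2 * A i $ 2 $ 1)" for i
  have \<tau>: "\<tau> i < 1" for i
    using mult_pos_pos[OF entry_pos[of i 1 1] entry_pos[of i 2 2]]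
      mult_pos_pos[OF entry_pos[of i 1 2] entry_pos[of i 2 1]]
    by (simp add: \<tau>_def divide_less_eq)
  \<comment> \<open>The extra 1/2 keeps \<open>\<theta>\<close> positive: \<open>\<tau> i\<close>
    vanishes for a singular \<open>A i\<close>.\<close>
  define \<theta> where "\<theta> = Max (insert (1/2) (range \<tau>))"
  have le: "\<tau> i \<le> \<theta>" for i
    unfolding \<theta>_def by (rule Max_ge) auto
  show ?thesis
  proof (rule that[of \<theta>])
    have "1/2 \<le> \<theta>" unfolding \<theta>_def by (rule Max_ge) auto
    then show "0 < \<theta>" by simp
    show "\<theta> < 1" unfolding \<theta>_def using \<tau> by (subst Max_less_iff) auto
    fix i and u v :: "real^2" assume uv: "positive_vector u" "positive_vector v"
    have eq: "log_ratio (A i *v x) = ln ((A i $ 1 $ 1 * (x $ 1 / x $ 2) + A i $ 1 $ 2) /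
        (A i $ 2 $ 1 * (x $ 1 / x $ 2) + A i $ 2 $ 2))" if "positive_vector x" for x
    proof -
      have "x $ 2 > 0" using that by (simp add: positive_vector_def)
      then have "A i $ 1 $ 1 * (x $ 1 / x $ 2) + A i $ 1 $ 2 = (A i *v x) $ 1 / x $ 2"
        "A i $ 2 $ 1 * (x $ 1 / x $ 2) + A i $ 2 $ 2 = (A i *v x) $ 2 / x $ 2"
        by (simp_all add: matrix_vector_mult_def sum_2 field_simps)
      then show ?thesis using \<open>x $ 2 > 0\<close> by (simp add: log_ratio_def)
    qed
    have "\<bar>log_ratio (A i *v u) - log_ratio (A i *v v)\<bar> \<le> \<tau> i * \<bar>log_ratio u - log_ratio v\<bar>"
      unfolding eq[OF uv(1)] eq[OF uv(2)] \<tau>_def log_ratio_def[of u] log_ratio_def[of v]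
      using uv entry_pos by (intro moebius_ln_contraction) (auto simp: positive_vector_def)
    also have "\<dots> \<le> \<theta> * \<bar>log_ratio u - log_ratio v\<bar>"
      by (intro mult_right_mono le) simp
    finally show "\<bar>log_ratio (A i *v u) - log_ratio (A i *v v)\<bar> \<le> \<theta> * \<bar>log_ratio u - log_ratio v\<bar>" .
  qed
qed

lemma positive_vector_1 [simp]: "positive_vector 1"
  by (simp add: positive_vector_def)

text \<open>The quotient of the entry sums of \<open>A i *v x\<close> and \<open>x\<close> is a
  Moebius function of the ratio \<open>x $ 1 / x $ 2\<close>, with the column sums of
  \<open>A i\<close> above and 1, 1 below. So \<open>moebius_ln_contraction\<close> serves a second
  time, now for the size instead of the direction.\<close>

lemma mean_incr_0_lipschitz:
  assumes "positive_vector u" "positive_vector v"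
  shows "\<bar>mean_incr A w 0 1 u - mean_incr A w 0 1 v\<bar> \<le> \<bar>log_ratio u - log_ratio v\<bar>"
proof -
  have eq: "mean_incr A w 0 1 x = (\<Sum>i\<in>UNIV. w i *
      ln (((A i $ 1 $ 1 + A i $ 2 $ 1) * (x $ 1 / x $ 2) + (A i $ 1 $ 2 + A i $ 2 $ 2)) /
        (1 * (x $ 1 / x $ 2) + 1)))" if "positive_vector x" for x
  proof -
    have x: "x $ 1 > 0" "x $ 2 > 0" using that by (simp_all add: positive_vector_def)
    have "ln (((A i $ 1 $ 1 + A i $ 2 $ 1) * (x $ 1 / x $ 2) + (A i $ 1 $ 2 + A i $ 2 $ 2)) /
        (1 * (x $ 1 / x $ 2) + 1)) = ln (1 \<bullet> (A i *v x)) - ln (1 \<bullet> x)" for i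
    proof -
      have "1 \<bullet> (A i *v x) > 0" "1 \<bullet> x > 0"
        using x positive_vector_mult[OF that, of i]
        by (auto simp: inner_vec_def sum_2 positive_vector_def intro!: add_pos_pos)
      moreover have "((A i $ 1 $ 1 + A i $ 2 $ 1) * (x $ 1 / x $ 2) + (A i $ 1 $ 2 + A i $ 2 $ 2)) /
        (1 * (x $ 1 / x $ 2) + 1) = (1 \<bullet> (A i *v x)) / (1 \<bullet> x)"
      proof -
        have "(A i $ 1 $ 1 + A i $ 2 $ 1) * (x $ 1 / x $ 2) + (A i $ 1 $ 2 + A i $ 2 $ 2)
          = (1 \<bullet> (A i *v x)) / x $ 2" "1 * (x $ 1 / x $ 2) + 1 = (1 \<bullet> x) / x $ 2"
          using x by (simp_all add: inner_vec_def matrix_vector_mult_def sum_2 field_simps)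
        then show ?thesis using x by simp
      qed
      ultimately show ?thesis by (simp add: ln_div)
    qed
    then show ?thesis
      by (simp add: mean_incr_def right_diff_distrib sum_subtractf mean_const)
  qed
  show ?thesis
    unfolding eq[OF assms(1)] eq[OF assms(2)]
  proof (rule mean_abs_diff_le)
    fix i
    let ?p = "A i $ 1 $ 1 + A i $ 2 $ 1" and ?q = "A i $ 1 $ 2 + A i $ 2 $ 2"
    have pq: "?p > 0" "?q > 0" using entry_pos[of i] by (auto intro: add_pos_pos)
    have "\<bar>ln ((?p * (u $ 1 / u $ 2) + ?q) / (1 * (u $ 1 / u $ 2) + 1)) -
        ln ((?p * (v $ 1 / v $ 2) + ?q) / (1 * (v $ 1 / v $ 2) + 1))\<bar>
      \<le> \<bar>?p * 1 - ?q * 1\<bar> / (?p * 1 + ?q * 1) * \<bar>ln (u $ 1 / u $ 2) - ln (v $ 1 / v $ 2)\<bar>"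
      using assms pq by (intro moebius_ln_contraction) (auto simp: positive_vector_def)
    also have "\<dots> \<le> 1 * \<bar>ln (u $ 1 / u $ 2) - ln (v $ 1 / v $ 2)\<bar>"
      using pq by (intro mult_right_mono) (auto simp: divide_le_eq)
    finally show "\<bar>ln ((?p * (u $ 1 / u $ 2) + ?q) / (1 * (u $ 1 / u $ 2) + 1)) -
        ln ((?p * (v $ 1 / v $ 2) + ?q) / (1 * (v $ 1 / v $ 2) + 1))\<bar> \<le> \<bar>log_ratio u - log_ratio v\<bar>"
      by (simp add: log_ratio_def)
  qed
qed

text \<open>Increment n + 1 averages increment n over the directions \<open>A i *v 1\<close>. The n
  letters that follow shrink the Hilbert distance of these directions to that of \<open>1\<close> by
  \<open>\<theta> ^ n\<close>, so consecutive increments are geometrically close.\<close>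

lemma mean_incr_converges:
  obtains l C \<theta> where "0 < C" "0 < \<theta>" "\<theta> < 1"
    "\<And>n. \<bar>mean_incr A w n 1 1 - l\<bar> \<le> C * \<theta> ^ n"
proof -
  obtain \<theta> where \<theta>: "0 < \<theta>" "\<theta> < 1"
    "\<And>i u v. positive_vector u \<Longrightarrow> positive_vector v \<Longrightarrow>
       \<bar>log_ratio (A i *v u) - log_ratio (A i *v v)\<bar> \<le> \<theta> * \<bar>log_ratio u - log_ratio v\<bar>"
    using log_ratio_contraction by metis
  have lip: "\<bar>mean_incr A w n 1 u - mean_incr A w n 1 v\<bar> \<le> \<theta> ^ n * \<bar>log_ratio u - log_ratio v\<bar>"
    if "positive_vector u" "positive_vector v" for n u v
    using that
  proof (induction n arbitrary: u v)
    case 0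
    then show ?case using mean_incr_0_lipschitz by simp
  next
    case (Suc n)
    show ?case
      unfolding mean_incr_Suc
    proof (rule mean_abs_diff_le)
      fix i
      have "\<bar>mean_incr A w n 1 (A i *v u) - mean_incr A w n 1 (A i *v v)\<bar>
          \<le> \<theta> ^ n * \<bar>log_ratio (A i *v u) - log_ratio (A i *v v)\<bar>"
        using Suc by (intro Suc.IH positive_vector_mult)
      also have "\<dots> \<le> \<theta> ^ n * (\<theta> * \<bar>log_ratio u - log_ratio v\<bar>)"
        using \<theta> Suc by (intro mult_left_mono) auto
      finally show "\<bar>mean_incr A w n 1 (A i *v u) - mean_incr A w n 1 (A i *v v)\<bar>
          \<le> \<theta> ^ Suc n * \<bar>log_ratio u - log_ratio v\<bar>"
        by (simp add: mult_ac)
    qed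
  qed
  \<comment> \<open>The summand 1 keeps the constant positive even if every matrix fixes the
    direction of \<open>1\<close>.\<close>
  define D where "D = 1 + (\<Sum>i\<in>UNIV. \<bar>log_ratio (A i *v 1) - log_ratio 1\<bar>)"
  have D: "\<bar>log_ratio (A i *v 1) - log_ratio 1\<bar> \<le> D" for i
    using member_le_sum[of i UNIV "\<lambda>i. \<bar>log_ratio (A i *v 1) - log_ratio 1\<bar>"]
    by (simp add: D_def)
  have D0: "D > 0"
    by (simp add: D_def add_pos_nonneg sum_nonneg)
  have "\<bar>mean_incr A w (Suc n) 1 1 - mean_incr A w n 1 1\<bar> \<le> D * \<theta> ^ n" for n
  proof -
    have "\<bar>(\<Sum>i\<in>UNIV. w i * mean_incr A w n 1 (A i *v 1)) - (\<Sum>i\<in>UNIV. w i * mean_incr A w n 1 1)\<bar>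
        \<le> D * \<theta> ^ n"
    proof (rule mean_abs_diff_le)
      fix i
      have "\<bar>mean_incr A w n 1 (A i *v 1) - mean_incr A w n 1 1\<bar>
          \<le> \<theta> ^ n * \<bar>log_ratio (A i *v 1) - log_ratio 1\<bar>"
        by (intro lip positive_vector_mult) auto
      also have "\<dots> \<le> \<theta> ^ n * D"
        using \<theta> D by (intro mult_left_mono) auto
      finally show "\<bar>mean_incr A w n 1 (A i *v 1) - mean_incr A w n 1 1\<bar> \<le> D * \<theta> ^ n"
        by (simp add: mult.commute)
    qed
    then show ?thesis
      by (simp only: mean_incr_Suc mean_const)
  qed
  then obtain l where "\<And>n. \<bar>mean_incr A w n 1 1 - l\<bar> \<le> D / (1 - \<theta>) * \<theta> ^ n"
    using geometric_limit[of "\<lambda>n. mean_incr A w n 1 1" D \<theta>] \<theta> by blast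
  then show ?thesis
    using that[of "D / (1 - \<theta>)" \<theta> l] D0 \<theta> by simp
qed

text \<open>The errors of the increments are summable, so \<open>mean_log\<close> stays within a
  bounded distance of n times \<open>l\<close>.\<close>

lemma mean_log_average:
  assumes "\<And>n. \<bar>mean_incr A w n 1 1 - l\<bar> \<le> C * \<theta> ^ n" "0 < \<theta>" "\<theta> < 1"
  shows "(\<lambda>n. mean_log A w n 1 1 / real n) \<longlonglongrightarrow> l"
proof -
  define a where "a n = mean_log A w n 1 1" for n
  define K where "K = \<bar>a 0\<bar> + C / (1 - \<theta>)"
  have "\<bar>a n - a 0 - real n * l\<bar> \<le> C / (1 - \<theta>)" for n
  proof -
    have "a n - a 0 = (\<Sum>k<n. a (Suc k) - a k)"
      by (rule sum_lessThan_telescope[symmetric])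
    then have "a n - a 0 - real n * l = (\<Sum>k<n. mean_incr A w k 1 1 - l)"
      by (simp add: a_def mean_incr_def sum_subtractf)
    also have "\<bar>\<dots>\<bar> \<le> (\<Sum>k<n. C * \<theta> ^ k)"
      by (intro order_trans[OF sum_abs] sum_mono assms)
    also have "\<dots> = C * ((1 - \<theta> ^ n) / (1 - \<theta>))"
      using assms by (simp add: sum_gp_strict flip: sum_distrib_left)
    also have "\<dots> \<le> C * (1 / (1 - \<theta>))"
      using assms(1)[of 0] assms(2,3) by (intro mult_left_mono divide_right_mono) auto
    finally show ?thesis by simp
  qed
  then have b: "\<bar>a n - real n * l\<bar> \<le> K" for n
    unfolding K_def using abs_triangle_ineq[of "a n - a 0 - real n * l" "a 0"]
    by (smt (verit) \<open>\<And>n. \<bar>a n - a 0 - real n * l\<bar> \<le> C / (1 - \<theta>)\<close>)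
  have "(\<lambda>n. a n / real n - l) \<longlonglongrightarrow> 0"
  proof (rule Lim_null_comparison)
    show "\<forall>\<^sub>F n in sequentially. norm (a n / real n - l) \<le> K / real n"
    proof (rule eventually_sequentiallyI[of 1])
      fix n :: nat assume "1 \<le> n"
      then have "a n / real n - l = (a n - real n * l) / real n" by (simp add: field_simps)
      then show "norm (a n / real n - l) \<le> K / real n"
        using b[of n] \<open>1 \<le> n\<close> by (simp add: abs_divide divide_right_mono)
    qed
    show "(\<lambda>n. K / real n) \<longlonglongrightarrow> 0"
      by (rule lim_const_over_n)
  qed
  then show ?thesis
    unfolding a_def by (simp add: LIM_zero_iff)
qed

end

section \<open>The Lyapunov exponent as a limit of means\<close>

text \<open>For a centred variable the linear term averages out, which leaves one plus a second
  moment. For negative \<open>x\<close>, multiplying by the quadratic Taylor polynomial of exp(-x)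
  gives a product of at least 1.\<close>

lemma exp_le_quadratic:
  fixes x :: real
  assumes "\<bar>x\<bar> \<le> 1"
  shows "exp x \<le> 1 + x + x\<^sup>2"
proof (cases "0 \<le> x")
  case True
  then show ?thesis using exp_bound assms by simp
next
  case False
  define z where "z = - x"
  have z: "0 \<le> z" using False by (simp add: z_def)
  have "1 * exp x \<le> (1 + x + x\<^sup>2) * (1 + z + z\<^sup>2 / 2) * exp x"
  proof (rule mult_right_mono)
    have "(1 + x + x\<^sup>2) * (1 + z + z\<^sup>2 / 2) = 1 + z\<^sup>2 / 2 + z ^ 3 / 2 + z ^ 4 / 2"
      by (simp add: z_def field_simps power2_eq_square power3_eq_cube power4_eq_xxxx)
    then show "1 \<le> (1 + x + x\<^sup>2) * (1 + z + z\<^sup>2 / 2)"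
      using z by simp
  qed simp
  also have "\<dots> \<le> (1 + x + x\<^sup>2) * exp z * exp x"
    using exp_lower_Taylor_quadratic[OF z] assms
    by (intro mult_right_mono mult_left_mono) auto
  also have "\<dots> = 1 + x + x\<^sup>2"
    by (simp add: z_def mult.assoc flip: exp_add)
  finally show ?thesis by simp
qed

lemma matrix_product_case_nat:
  "matrix_product A (case_nat i x) (Suc n) = matrix_product A x n ** A i"
proof (induction n)
  case (Suc n)
  then show ?case
    unfolding matrix_product.simps(2)[of A _ "Suc n"] by (simp add: matrix_mul_assoc)
qed simp

context positive_family
begin

abbreviation letter_measure :: "'i measure" where
  "letter_measure \<equiv> point_measure UNIV (\<lambda>i. ennreal (w i))"

lemma prob_space_letter: "prob_space letter_measure"
proof
  have "emeasure letter_measure UNIV = (\<Sum>i\<in>UNIV. ennreal (w i))"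
    by (rule emeasure_point_measure_finite) auto
  also have "\<dots> = ennreal (\<Sum>i\<in>UNIV. w i)"
    using w_pos by (intro sum_ennreal) (auto simp: less_imp_le)
  finally show "emeasure letter_measure (space letter_measure) = 1"
    by (simp add: w_sum space_point_measure)
qed

lemma sequence_space_letter: "sequence_space letter_measure"
  unfolding sequence_space_def using prob_space_letter by (intro product_prob_spaceI)

lemma prob_space_bernoulli: "prob_space (bernoulli_measure w)"
  unfolding bernoulli_measure_def by (intro prob_space_PiM prob_space_letter)

text \<open>Self-similarity of the product measure: a random sequence is a letter followed by an
  independent sequence of the same law. It turns the recursion of \<open>mean_log\<close> into a
  statement about integrals.\<close>

lemma nn_integral_bernoulli_case_nat:
  assumes [measurable]: "f \<in> borel_measurable (bernoulli_measure w)"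
  shows "(\<integral>\<^sup>+x. f x \<partial>bernoulli_measure w)
    = (\<Sum>i\<in>UNIV. ennreal (w i) * (\<integral>\<^sup>+x. f (case_nat i x) \<partial>bernoulli_measure w))"
proof -
  interpret sequence_space letter_measure by (rule sequence_space_letter)
  have S: "bernoulli_measure w = S" by (simp add: bernoulli_measure_def)
  have f [measurable]: "f \<in> borel_measurable S" using assms unfolding S .
  have "(\<integral>\<^sup>+x. f x \<partial>S) = (\<integral>\<^sup>+x. f x \<partial>distr (letter_measure \<Otimes>\<^sub>M S) S (\<lambda>(s, \<omega>). case_nat s \<omega>))"
    by (simp only: PiM_iter)
  also have "\<dots> = (\<integral>\<^sup>+y. f (case y of (s, \<omega>) \<Rightarrow> case_nat s \<omega>) \<partial>(letter_measure \<Otimes>\<^sub>M S))"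
    by (rule nn_integral_distr) measurable
  also have "\<dots> = (\<integral>\<^sup>+s. \<integral>\<^sup>+\<omega>. f (case_nat s \<omega>) \<partial>S \<partial>letter_measure)"
    by (subst P.nn_integral_fst[symmetric]) (auto simp: case_prod_unfold)
  also have "\<dots> = (\<Sum>i\<in>UNIV. ennreal (w i) * (\<integral>\<^sup>+x. f (case_nat i x) \<partial>S))"
    by (rule nn_integral_point_measure_finite) simp
  finally show ?thesis by (simp only: S)
qed

text \<open>The product takes only finitely many values for each n, so it is measurable even for the
  discrete sigma-algebra; then any function of it is measurable without regularity.\<close>

lemma measurable_matrix_product:
  "(\<lambda>x. matrix_product A x n) \<in> measurable (bernoulli_measure w) (count_space UNIV)"
proof (induction n)
  case (Suc n)
  have "(\<lambda>x. x n) \<in> measurable (bernoulli_measure w) letter_measure"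
    unfolding bernoulli_measure_def by (rule measurable_component_singleton) simp
  moreover have "measurable (bernoulli_measure w) letter_measure
      = measurable (bernoulli_measure w) (count_space UNIV)"
    by (intro measurable_cong_sets) (auto simp: sets_point_measure)
  ultimately have c: "(\<lambda>x. x n) \<in> measurable (bernoulli_measure w) (count_space UNIV)"
    by simp
  have "(\<lambda>x. A i ** matrix_product A x n) \<in> measurable (bernoulli_measure w) (count_space UNIV)" for i
    by (rule measurable_compose[OF Suc.IH]) simp
  from measurable_compose_countable[OF this c] show ?case
    by simp
qed simp

lemma measurable_fun_matrix_product [measurable]:
  "(\<lambda>x. g (matrix_product A x n)) \<in> borel_measurable (bernoulli_measure w)"
  by (rule measurable_compose[OF measurable_matrix_product]) simp

section \<open>Concentration of the logarithm around its mean\<close>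

definition log_deviation :: "nat \<Rightarrow> real^2 \<Rightarrow> (nat \<Rightarrow> 'i) \<Rightarrow> real" where
  "log_deviation n v x = ln (1 \<bullet> (matrix_product A x n *v v)) - mean_log A w n 1 v"

lemma measurable_log_deviation [measurable]:
  "log_deviation n v \<in> borel_measurable (bernoulli_measure w)"
  unfolding log_deviation_def by measurable

text \<open>Azuma's argument: given the first letter, the conditional mean of the logarithm moves by at
  most $B$, so each letter contributes a factor $1 + (tB)^2$.\<close>

lemma log_deviation_exp_moment:
  assumes "B > 0" "\<And>n v i j. positive_vector v \<Longrightarrow>
       \<bar>mean_log A w n 1 (A i *v v) - mean_log A w n 1 (A j *v v)\<bar> \<le> B"
    and "\<bar>t\<bar> * B \<le> 1" "positive_vector v"
  shows "(\<integral>\<^sup>+x. ennreal (exp (t * log_deviation n v x)) \<partial>bernoulli_measure w)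
    \<le> ennreal ((1 + (t * B)\<^sup>2) ^ n)"
  using assms(4)
proof (induction n arbitrary: v)
  case 0
  interpret prob_space "bernoulli_measure w" by (rule prob_space_bernoulli)
  show ?case by (simp add: log_deviation_def emeasure_space_1)
next
  case (Suc n)
  define K where "K = 1 + (t * B)\<^sup>2"
  \<comment> \<open>The martingale difference revealed by the first letter. It is centred because
    \<open>mean_log\<close> at \<open>Suc n\<close> is by definition the average over that
    letter.\<close>
  define y where "y i = mean_log A w n 1 (A i *v v) - mean_log A w (Suc n) 1 v" for i
  have y0: "(\<Sum>i\<in>UNIV. w i * y i) = 0"
    by (simp add: y_def right_diff_distrib sum_subtractf mean_const)
  have yB: "\<bar>y i\<bar> \<le> B" for i
  proof -
    have "\<bar>(\<Sum>j\<in>UNIV. w j * mean_log A w n 1 (A i *v v)) - (\<Sum>j\<in>UNIV. w j * mean_log A w n 1 (A j *v v))\<bar> \<le> B"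
      by (rule mean_abs_diff_le) (rule assms(2)[OF Suc.prems])
    then show ?thesis by (simp add: mean_const y_def)
  qed
  have dev: "log_deviation (Suc n) v (case_nat i x) = y i + log_deviation n (A i *v v) x" for i x
    by (simp add: log_deviation_def y_def matrix_product_case_nat matrix_vector_mul_assoc
        del: matrix_product.simps mean_log.simps)
  have "(\<integral>\<^sup>+x. ennreal (exp (t * log_deviation (Suc n) v x)) \<partial>bernoulli_measure w)
      = (\<Sum>i\<in>UNIV. ennreal (w i) *
          (\<integral>\<^sup>+x. ennreal (exp (t * log_deviation (Suc n) v (case_nat i x))) \<partial>bernoulli_measure w))"
    by (rule nn_integral_bernoulli_case_nat) measurable
  also have "\<dots> = (\<Sum>i\<in>UNIV. ennreal (w i) * (ennreal (exp (t * y i)) *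
          (\<integral>\<^sup>+x. ennreal (exp (t * log_deviation n (A i *v v) x)) \<partial>bernoulli_measure w)))"
    unfolding dev distrib_left exp_add
    by (simp add: ennreal_mult nn_integral_cmult)
  also have "\<dots> \<le> (\<Sum>i\<in>UNIV. ennreal (w i) * (ennreal (exp (t * y i)) * ennreal (K ^ n)))"
    unfolding K_def
    by (intro sum_mono mult_left_mono Suc.IH positive_vector_mult Suc.prems) auto
  also have "\<dots> = ennreal (\<Sum>i\<in>UNIV. w i * (exp (t * y i) * K ^ n))"
    using w_pos by (simp add: K_def sum_ennreal less_imp_le flip: ennreal_mult)
  also have "(\<Sum>i\<in>UNIV. w i * (exp (t * y i) * K ^ n)) \<le> K * K ^ n"
  proof -
    have "(\<Sum>i\<in>UNIV. w i * exp (t * y i)) \<le> (\<Sum>i\<in>UNIV. w i * (K + t * y i))"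
    proof (intro sum_mono mult_left_mono)
      fix i
      have "\<bar>t * y i\<bar> \<le> \<bar>t * B\<bar>"
        using yB[of i] assms(1) by (simp add: abs_mult mult_left_mono)
      moreover from this have "(t * y i)\<^sup>2 \<le> (t * B)\<^sup>2"
        by (simp add: abs_le_square_iff)
      moreover have "\<bar>t * B\<bar> \<le> 1" using assms(1,3) by (simp add: abs_mult)
      ultimately show "exp (t * y i) \<le> K + t * y i"
        using exp_le_quadratic[of "t * y i"] by (simp add: K_def)
    qed (use w_pos in \<open>simp add: less_imp_le\<close>)
    also have "\<dots> = (\<Sum>i\<in>UNIV. w i * K) + t * (\<Sum>i\<in>UNIV. w i * y i)"
      by (simp add: distrib_left sum.distrib sum_distrib_left mult_ac)
    also have "\<dots> = K" by (simp only: mean_const y0)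
    finally have "(\<Sum>i\<in>UNIV. w i * exp (t * y i)) * K ^ n \<le> K * K ^ n"
      by (intro mult_right_mono) (auto simp: K_def)
    then show ?thesis by (simp add: sum_distrib_right mult.assoc)
  qed
  finally show ?case
    by (simp add: K_def ennreal_leI)
qed

lemma log_deviation_tail:
  assumes "\<eta> > 0" "s = 1 \<or> s = - 1"
  shows "AE x in bernoulli_measure w.
    \<forall>\<^sub>F n in sequentially. s * log_deviation n 1 x < \<eta> * real n"
proof -
  interpret prob_space "bernoulli_measure w" by (rule prob_space_bernoulli)
  obtain B where B: "B > 0" "\<And>n u v i j. positive_vector u \<Longrightarrow> positive_vector v \<Longrightarrow>
       \<bar>mean_log A w n u (A i *v v) - mean_log A w n u (A j *v v)\<bar> \<le> B"
    using mean_log_oscillation by blast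
  \<comment> \<open>The first entry makes the exponential moment bound applicable. The second gives
    \<open>(\<tau> * B)\<^sup>2 \<le> \<tau> * \<eta> / 2\<close>, so the growth of the moment uses
    up at most half of the exponential decay from Markov's inequality; what remains is the rate
    \<open>r\<close>.\<close>
  define \<tau> where "\<tau> = min (1 / B) (\<eta> / (2 * B\<^sup>2))"
  have \<tau>: "\<tau> > 0" "\<tau> * B \<le> 1" "\<tau> * B\<^sup>2 \<le> \<eta> / 2"
  proof -
    show "\<tau> > 0" using assms B by (simp add: \<tau>_def)
    have "\<tau> * B \<le> 1 / B * B" using B by (intro mult_right_mono) (auto simp: \<tau>_def)
    then show "\<tau> * B \<le> 1" using B by simp
    have "\<tau> * B\<^sup>2 \<le> \<eta> / (2 * B\<^sup>2) * B\<^sup>2" by (intro mult_right_mono) (auto simp: \<tau>_def)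
    then show "\<tau> * B\<^sup>2 \<le> \<eta> / 2" using B by simp
  qed
  define r where "r = exp (- (\<tau> * \<eta> / 2))"
  define bad where "bad n = {x \<in> space (bernoulli_measure w). \<eta> * real n \<le> s * log_deviation n 1 x}" for n
  have bad [measurable]: "bad n \<in> sets (bernoulli_measure w)" for n
    unfolding bad_def by measurable
  have prob_bad: "prob (bad n) \<le> r ^ n" for n
  proof -
    let ?u = "\<lambda>x. ennreal (exp (s * \<tau> * log_deviation n 1 x))"
    let ?c = "ennreal (exp (- (\<tau> * \<eta> * real n)))"
    have "bad n \<subseteq> {x \<in> space (bernoulli_measure w). 1 \<le> ?c * ?u x}"
    proof
      fix x assume x: "x \<in> bad n"
      then have "\<tau> * (\<eta> * real n) \<le> \<tau> * (s * log_deviation n 1 x)"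
        using \<tau>(1) by (intro mult_left_mono) (auto simp: bad_def)
      then have "0 \<le> - (\<tau> * \<eta> * real n) + s * \<tau> * log_deviation n 1 x"
        by (simp add: mult_ac)
      then have "1 \<le> exp (- (\<tau> * \<eta> * real n) + s * \<tau> * log_deviation n 1 x)"
        by simp
      then show "x \<in> {x \<in> space (bernoulli_measure w). 1 \<le> ?c * ?u x}"
        using x by (simp add: bad_def flip: ennreal_mult exp_add)
    qed
    then have "emeasure (bernoulli_measure w) (bad n)
        \<le> emeasure (bernoulli_measure w) {x \<in> space (bernoulli_measure w). 1 \<le> ?c * ?u x}"
      by (rule emeasure_mono) measurable
    also have "\<dots> \<le> ?c * (\<integral>\<^sup>+x. ?u x \<partial>bernoulli_measure w)"
      using nn_integral_Markov_inequality[where u = ?u and M = "bernoulli_measure w"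
          and A = "space (bernoulli_measure w)" and c = ?c]
      by (simp add: indicator_def cong: nn_integral_cong)
    also have "\<dots> \<le> ?c * ennreal ((1 + (s * \<tau> * B)\<^sup>2) ^ n)"
    proof (intro mult_left_mono log_deviation_exp_moment)
      show "\<bar>s * \<tau>\<bar> * B \<le> 1" using assms(2) \<tau> by auto
    qed (use B in auto)
    also have "\<dots> = ennreal (exp (- (\<tau> * \<eta> * real n)) * (1 + (\<tau> * B)\<^sup>2) ^ n)"
      using assms(2) by (auto simp flip: ennreal_mult)
    also have "\<dots> \<le> ennreal (r ^ n)"
    proof (rule ennreal_leI)
      have "1 + (\<tau> * B)\<^sup>2 \<le> exp ((\<tau> * B)\<^sup>2)"
        by (rule exp_ge_add_one_self)
      also have "\<dots> \<le> exp (\<tau> * \<eta> / 2)"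
        using mult_left_mono[OF \<tau>(3), of \<tau>] \<tau>(1) by (simp add: power2_eq_square mult_ac)
      finally have "(1 + (\<tau> * B)\<^sup>2) ^ n \<le> exp (\<tau> * \<eta> / 2) ^ n"
        by (intro power_mono) auto
      then have "exp (- (\<tau> * \<eta> * real n)) * (1 + (\<tau> * B)\<^sup>2) ^ n
          \<le> exp (- (\<tau> * \<eta> * real n)) * exp (\<tau> * \<eta> / 2) ^ n"
        by (intro mult_left_mono) auto
      also have "\<dots> = r ^ n"
        by (simp add: r_def exp_of_nat_mult[symmetric] algebra_simps flip: exp_add)
      finally show "exp (- (\<tau> * \<eta> * real n)) * (1 + (\<tau> * B)\<^sup>2) ^ n \<le> r ^ n" .
    qed
    finally show ?thesis
      by (simp add: emeasure_eq_measure r_def)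
  qed
  have "AE x in bernoulli_measure w.
      \<forall>\<^sub>F n in sequentially. x \<in> space (bernoulli_measure w) - bad n"
  proof (rule borel_cantelli_AE1)
    show "summable (\<lambda>n. prob (bad n))"
    proof (rule summable_comparison_test'[of "\<lambda>n. r ^ n" 0])
      show "summable (\<lambda>n. r ^ n)"
        using assms \<tau> by (intro summable_geometric) (simp add: r_def)
    qed (use prob_bad in simp)
  qed (auto simp: emeasure_eq_measure)
  then show ?thesis
    by eventually_elim (auto simp: bad_def not_le elim: eventually_mono)
qed

section \<open>From the means to the almost sure limit\<close>

lemma positive_matrix_product: "positive_matrix (matrix_product A x (Suc n))"
proof (induction n)
  case 0
  then show ?case using A_pos by simp
next
  case (Suc n)
  then show ?case
    using entry_pos[of "x (Suc n)"]
    unfolding matrix_product.simps(2)[of A x "Suc n"]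
    by (auto simp: positive_matrix_def matrix_matrix_mult_def sum_2 intro!: add_pos_pos)
qed

text \<open>For a positive matrix \<open>1 \<bullet> (P *v 1)\<close> is the entry sum, which lies
  between the norm and four times the norm. The discrepancy disappears after division by n.\<close>

lemma ln_norm_positive_matrix:
  fixes P :: "real^2^2"
  assumes "positive_matrix P"
  shows "\<bar>ln (norm P) - ln (1 \<bullet> (P *v 1))\<bar> \<le> ln 4"
proof -
  have P: "P $ k $ l > 0" for k l using assms by (simp add: positive_matrix_def)
  have s: "1 \<bullet> (P *v 1) = P $ 1 $ 1 + P $ 1 $ 2 + (P $ 2 $ 1 + P $ 2 $ 2)"
    by (simp add: inner_vec_def matrix_vector_mult_def sum_2)
  have s0: "1 \<bullet> (P *v 1) > 0"
    unfolding s using P by (intro add_pos_pos)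
  have "norm P \<le> (\<Sum>k\<in>UNIV. norm (P $ k))"
    unfolding norm_vec_def by (rule L2_set_le_sum) simp
  also have "\<dots> \<le> (\<Sum>k\<in>UNIV. \<Sum>l\<in>UNIV. \<bar>P $ k $ l\<bar>)"
    by (intro sum_mono norm_le_l1_cart)
  also have "\<dots> = 1 \<bullet> (P *v 1)"
    using P by (simp add: s sum_2 less_imp_le)
  finally have le: "norm P \<le> 1 \<bullet> (P *v 1)" .
  have "P $ k $ l \<le> norm P" for k l
    using component_le_norm_cart[of "P $ k" l] Finite_Cartesian_Product.norm_nth_le[of P k] by linarith
  then have ge: "1 \<bullet> (P *v 1) \<le> 4 * norm P"
    unfolding s by (smt (verit))
  have "norm P > 0" using s0 ge by linarith
  have "ln (norm P) \<le> ln (1 \<bullet> (P *v 1))"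
    using le \<open>norm P > 0\<close> by (intro ln_mono)
  moreover have "ln (1 \<bullet> (P *v 1)) \<le> ln (4 * norm P)"
    using ge s0 by (intro ln_mono)
  ultimately show ?thesis
    using \<open>norm P > 0\<close> by (simp add: ln_mult)
qed

lemma lyapunov_exponent_eqI:
  assumes lim: "(\<lambda>n. mean_log A w n 1 1 / real n) \<longlonglongrightarrow> l"
  shows "lyapunov_exponent A w = l"
proof -
  interpret prob_space "bernoulli_measure w" by (rule prob_space_bernoulli)
  \<comment> \<open>Countably many tolerances and two signs, so that one null set serves them
    all.\<close>
  have "AE x in bernoulli_measure w. \<forall>k::nat. \<forall>s\<in>{1, -1}. \<forall>\<^sub>F n in sequentially.
      s * log_deviation n 1 x < inverse (real (Suc k)) * real n"
    by (intro AE_all_countable[THEN iffD2] allI AE_finite_allI log_deviation_tail) auto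
  then have ae: "AE x in bernoulli_measure w.
      (\<lambda>n. ln (norm (matrix_product A x n)) / real n) \<longlonglongrightarrow> l"
  proof eventually_elim
    fix x assume x: "\<forall>k::nat. \<forall>s\<in>{1, -1}. \<forall>\<^sub>F n in sequentially.
      s * log_deviation n 1 x < inverse (real (Suc k)) * real n"
    have dev: "(\<lambda>n. log_deviation n 1 x / real n) \<longlonglongrightarrow> 0"
    proof (rule tendstoI)
      fix e :: real assume "e > 0"
      then obtain k where k: "inverse (real (Suc k)) < e"
        using reals_Archimedean by blast
      have "\<forall>\<^sub>F n in sequentially. 1 * log_deviation n 1 x < inverse (real (Suc k)) * real n"
        "\<forall>\<^sub>F n in sequentially. - 1 * log_deviation n 1 x < inverse (real (Suc k)) * real n"
        using x by blast+
      then show "\<forall>\<^sub>F n in sequentially. dist (log_deviation n 1 x / real n) 0 < e"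
        using eventually_gt_at_top[of 0]
      proof eventually_elim
        fix n :: nat
        assume n: "1 * log_deviation n 1 x < inverse (real (Suc k)) * real n"
          "- 1 * log_deviation n 1 x < inverse (real (Suc k)) * real n" "0 < n"
        have "\<bar>log_deviation n 1 x\<bar> < inverse (real (Suc k)) * real n"
          using n by linarith
        also have "\<dots> < e * real n"
          using n k by (intro mult_strict_right_mono) auto
        finally show "dist (log_deviation n 1 x / real n) 0 < e"
          using n by (simp add: dist_norm abs_divide divide_less_eq)
      qed
    qed
    define d where "d n = ln (norm (matrix_product A x n)) - ln (1 \<bullet> (matrix_product A x n *v 1))" for n
    have d: "(\<lambda>n. d n / real n) \<longlonglongrightarrow> 0"
    proof (rule Lim_null_comparison)
      show "\<forall>\<^sub>F n in sequentially. norm (d n / real n) \<le> ln 4 / real n"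
      proof (rule eventually_sequentiallyI[of 1])
        fix n :: nat assume "1 \<le> n"
        \<comment> \<open>The empty product is the identity, which is not positive; hence the start
          at 1.\<close>
        then obtain m where "n = Suc m" by (cases n) auto
        then have "\<bar>d n\<bar> \<le> ln 4"
          unfolding d_def using ln_norm_positive_matrix positive_matrix_product by blast
        then show "norm (d n / real n) \<le> ln 4 / real n"
          by (simp add: abs_divide divide_right_mono)
      qed
      show "(\<lambda>n. ln 4 / real n) \<longlonglongrightarrow> 0" by (rule lim_const_over_n)
    qed
    have "(\<lambda>n. d n / real n + (log_deviation n 1 x / real n + mean_log A w n 1 1 / real n))
        \<longlonglongrightarrow> 0 + (0 + l)"
      by (intro tendsto_add d dev lim)
    moreover have "d n / real n + (log_deviation n 1 x / real n + mean_log A w n 1 1 / real n)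
        = ln (norm (matrix_product A x n)) / real n" for n
      by (simp add: d_def log_deviation_def flip: add_divide_distrib)
    ultimately show "(\<lambda>n. ln (norm (matrix_product A x n)) / real n) \<longlonglongrightarrow> l" by simp
  qed
  show ?thesis
    unfolding lyapunov_exponent_def
  proof (intro the_equality ae)
    fix l' assume "AE x in bernoulli_measure w.
        (\<lambda>n. ln (norm (matrix_product A x n)) / real n) \<longlonglongrightarrow> l'"
    with ae have "AE x in bernoulli_measure w. l' = l"
      by eventually_elim (rule LIMSEQ_unique)
    then show "l' = l"
      by simp
  qed
qed

end

section \<open>Power series of powers of a Moebius map\<close>

text \<open>The coefficient of $x^k$ in $(c + t x / (1 + b x))^n$.\<close>

definition moebius_coeff :: "'a::field_char_0 \<Rightarrow> 'a \<Rightarrow> 'a \<Rightarrow> nat \<Rightarrow> nat \<Rightarrow> 'a" where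
  "moebius_coeff c b t n k =
     (if k = 0 then c ^ n
      else (\<Sum>l = 1..min k n. of_nat (n choose l) * of_nat ((k - 1) choose (l - 1)) *
         c ^ (n - l) * (- b) ^ (k - l) * t ^ l))"

lemma of_real_moebius_coeff:
  "of_real (moebius_coeff c b t n k) = moebius_coeff (of_real c) (of_real b) (of_real t) n k"
  by (simp add: moebius_coeff_def)

lemma fps_moebius_power:
  \<comment> \<open>With y = t x / (1 + b x), the binomial theorem expands (c + y)^n, and the
    negative binomial series gives the coefficients of y^l, namely
    \<open>(k - 1) choose (l - 1)\<close> times powers of -b and t.\<close>
  fixes c b t :: "'a::field_char_0"
  shows "(fps_const c + fps_const t * fps_X * inverse (1 + fps_const b * fps_X)) ^ n
    = Abs_fps (moebius_coeff c b t n)"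
proof (rule fps_ext)
  fix k
  define y where "y = fps_const t * fps_X * inverse (1 + fps_const b * fps_X)"
  have y_nth: "fps_nth (y ^ l) k = (if k < l then 0
      else of_nat ((k - 1) choose (l - 1)) * (- b) ^ (k - l) * t ^ l)" if "l \<ge> 1" for l
  proof -
    have "y ^ l = fps_const (t ^ l) * (fps_X ^ l * inverse ((1 - fps_const (- b) * fps_X) ^ l))"
      by (simp add: y_def power_mult_distrib fps_inverse_power mult.assoc fps_const_power
          flip: fps_const_neg)
    also have "inverse ((1 - fps_const (- b) * fps_X) ^ l)
        = Abs_fps (\<lambda>k. of_nat ((l + k - 1) choose k) * (- b) ^ k)"
      using that by (intro one_minus_const_fps_X_neg_power') simp
    finally have "fps_nth (y ^ l) k = (if k < l then 0
        else t ^ l * (of_nat ((l + (k - l) - 1) choose (k - l)) * (- b) ^ (k - l)))"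
      by (simp add: fps_X_power_mult_nth)
    moreover have "(l + (k - l) - 1) choose (k - l) = (k - 1) choose (l - 1)" if "l \<le> k"
      using that \<open>l \<ge> 1\<close> binomial_symmetric[of "k - l" "k - 1"] by simp
    ultimately show ?thesis
      by auto
  qed
  have "fps_nth ((fps_const c + y) ^ n) k = fps_nth ((y + fps_const c) ^ n) k"
    by (simp add: add.commute)
  also have "\<dots> = (\<Sum>l\<le>n. of_nat (n choose l) * (fps_nth (y ^ l) k) * c ^ (n - l))"
    by (simp add: binomial_ring fps_sum_nth fps_const_power flip: fps_of_nat)
  also have "\<dots> = moebius_coeff c b t n k"
  proof (cases "k = 0")
    case True
    have "fps_nth y 0 = 0"
      by (simp add: y_def)
    then have "fps_nth (y ^ l) 0 = (if l = 0 then 1 else 0)" for l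
      by (simp add: fps_power_zeroth power_0_left)
    then have "(\<Sum>l\<le>n. of_nat (n choose l) * (fps_nth (y ^ l) k) * c ^ (n - l))
        = (\<Sum>l\<le>n. if l = 0 then c ^ n else 0)"
      using True by (intro sum.cong) auto
    then show ?thesis
      using True by (simp add: moebius_coeff_def)
  next
    case False
    have "(\<Sum>l\<le>n. of_nat (n choose l) * (fps_nth (y ^ l) k) * c ^ (n - l))
        = (\<Sum>l = 1..min k n. of_nat (n choose l) * (fps_nth (y ^ l) k) * c ^ (n - l))"
    proof (rule sum.mono_neutral_right)
      show "\<forall>l\<in>{..n} - {1..min k n}. of_nat (n choose l) * (fps_nth (y ^ l) k) * c ^ (n - l) = 0"
      proof
        fix l assume l: "l \<in> {..n} - {1..min k n}"
        show "of_nat (n choose l) * (fps_nth (y ^ l) k) * c ^ (n - l) = 0"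
          by (cases "l = 0") (use l False y_nth[of l] in auto)
      qed
    qed auto
    also have "\<dots> = moebius_coeff c b t n k"
      using False by (auto simp: moebius_coeff_def y_nth mult_ac intro!: sum.cong)
    finally show ?thesis .
  qed
  finally show "fps_nth ((fps_const c + fps_const t * fps_X * inverse (1 + fps_const b * fps_X)) ^ n) k
      = fps_nth (Abs_fps (moebius_coeff c b t n)) k"
    by (simp add: y_def)
qed

text \<open>The generating series H_n satisfies (1 + b x) H_(n+1) = (c + (c b + t) x) H_n; the
  recursion compares coefficients of x^(k+1). It replaces the double binomial sum by a constant
  amount of work per entry.\<close>

lemma moebius_coeff_Suc:
  fixes c b t :: "'a::field_char_0"
  shows "moebius_coeff c b t (Suc n) (Suc k) = c * moebius_coeff c b t n (Suc k)
    + (c * b + t) * moebius_coeff c b t n k - b * moebius_coeff c b t (Suc n) k"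
proof -
  define H where "H n = Abs_fps (moebius_coeff c b t n)" for n
  define u where "u = 1 + fps_const b * fps_X"
  have "inverse u * u = 1"
    by (rule inverse_mult_eq_1) (simp add: u_def)
  then have u: "(fps_const c + fps_const t * fps_X * inverse u) * u = fps_const c * u + fps_const t * fps_X"
    by (simp add: distrib_right mult.assoc)
  have "H (Suc n) = (fps_const c + fps_const t * fps_X * inverse u) * H n"
    by (simp add: H_def u_def flip: fps_moebius_power)
  then have "H (Suc n) * u = ((fps_const c + fps_const t * fps_X * inverse u) * u) * H n"
    by (simp only: mult.assoc mult.commute[of "H n" u])
  then have "H (Suc n) * u = (fps_const c * u + fps_const t * fps_X) * H n"
    unfolding u .
  then have "fps_nth (H (Suc n) * u) (Suc k) = fps_nth ((fps_const c * u + fps_const t * fps_X) * H n) (Suc k)"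
    by simp
  then show ?thesis
    by (simp add: u_def H_def algebra_simps)
qed

text \<open>On the circle both squared moduli are affine in the real part of $z$, so it suffices to compare
  them at $z = \pm R$.\<close>

lemma moebius_cmod_le_1:
  fixes c b e R :: real
  assumes "R > 0" "\<bar>c + e * R\<bar> \<le> 1 + b * R" "\<bar>c - e * R\<bar> \<le> 1 - b * R" "cmod z = R"
  shows "cmod (of_real c + of_real e * z) \<le> cmod (1 + of_real b * z)"
proof -
  define x y where "x = Re z" and "y = Im z"
  have xy: "x\<^sup>2 + y\<^sup>2 = R\<^sup>2"
    using assms(4) by (simp add: x_def y_def flip: cmod_power2)
  have x: "\<bar>x\<bar> \<le> R"
    using abs_Re_le_cmod[of z] assms(4) by (simp add: x_def)
  define D where "D u = (1 + 2 * b * u + b\<^sup>2 * R\<^sup>2) - (c\<^sup>2 + 2 * c * e * u + e\<^sup>2 * R\<^sup>2)" for u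
  have "(c + e * R)\<^sup>2 \<le> (1 + b * R)\<^sup>2" "(c - e * R)\<^sup>2 \<le> (1 - b * R)\<^sup>2"
    using assms by (auto intro!: abs_le_square_iff[THEN iffD1])
  then have D: "0 \<le> D R" "0 \<le> D (- R)"
    by (simp_all add: D_def power2_eq_square algebra_simps)
  have "2 * R * D x = (R + x) * D R + (R - x) * D (- R)"
    by (simp add: D_def algebra_simps)
  also have "\<dots> \<ge> 0"
    using D x by (intro add_nonneg_nonneg[OF mult_nonneg_nonneg mult_nonneg_nonneg]) linarith+
  finally have "0 \<le> D x"
    using assms(1) by (simp add: zero_le_mult_iff)
  then have "c\<^sup>2 + 2 * c * e * x + e\<^sup>2 * R\<^sup>2 \<le> 1 + 2 * b * x + b\<^sup>2 * R\<^sup>2"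
    by (simp only: D_def diff_ge_0_iff_ge)
  moreover have "(cmod (of_real c + of_real e * z))\<^sup>2 = c\<^sup>2 + 2 * c * e * x + e\<^sup>2 * R\<^sup>2"
    "(cmod (1 + of_real b * z))\<^sup>2 = 1 + 2 * b * x + b\<^sup>2 * R\<^sup>2"
    unfolding cmod_power2 xy[symmetric]
    by (simp_all add: x_def y_def power2_eq_square algebra_simps)
  ultimately have "(cmod (of_real c + of_real e * z))\<^sup>2 \<le> (cmod (1 + of_real b * z))\<^sup>2"
    by (simp only:)
  then show ?thesis
    by (rule power2_le_imp_le) simp
qed

text \<open>The hypotheses keep the pole outside the closed disc of radius R and bound the map by 1
  at R and -R; here t + b c is the coefficient of x in the numerator. A function bounded by 1 on the
  circle has all its powers bounded by 1, so the Cauchy estimate is uniform in n.\<close>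

lemma moebius_power_series:
  fixes c b t R :: real
  assumes R: "R > 0" and "\<bar>b\<bar> * R < 1"
    and "\<bar>c + (t + b * c) * R\<bar> \<le> 1 + b * R" "\<bar>c - (t + b * c) * R\<bar> \<le> 1 - b * R"
  shows moebius_coeff_bound: "\<bar>moebius_coeff c b t n k\<bar> \<le> 1 / R ^ k"
    and moebius_coeff_sums: "\<bar>x\<bar> < R \<Longrightarrow>
      (\<lambda>k. moebius_coeff c b t n k * x ^ k) sums ((c + t * x / (1 + b * x)) ^ n)"
proof -
  define h where "h z = (complex_of_real c + of_real t * z * inverse (1 + of_real b * z)) ^ n" for z
  have ne: "1 + of_real b * z \<noteq> 0" if "cmod z \<le> R" for z
  proof
    assume "1 + of_real b * z = 0"
    then have "of_real b * z = - 1" by (simp add: add_eq_0_iff)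
    then have "1 = \<bar>b\<bar> * cmod z" by (metis norm_minus_cancel norm_mult norm_of_real norm_one)
    also have "\<dots> \<le> \<bar>b\<bar> * R" using that by (intro mult_left_mono) auto
    finally show False using assms(2) by simp
  qed
  have hol: "h holomorphic_on ball 0 R"
    unfolding h_def using ne by (auto intro!: holomorphic_intros)
  have cont: "continuous_on (cball 0 R) h"
    unfolding h_def using ne by (auto intro!: continuous_intros)
  have "h has_fps_expansion (fps_const (complex_of_real c) + fps_const (of_real t) * fps_X *
      inverse (1 + fps_const (of_real b) * fps_X)) ^ n"
    unfolding h_def by (intro fps_expansion_intros) simp_all
  then have coeff: "(deriv ^^ k) h 0 / fact k = of_real (moebius_coeff c b t n k)" for k
    unfolding fps_moebius_power by (simp add: fps_nth_fps_expansion[symmetric] of_real_moebius_coeff)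
  have bound: "cmod (h z) \<le> 1" if "cmod (0 - z) = R" for z
  proof -
    have z: "cmod z = R" using that by simp
    have "complex_of_real c + of_real t * z * inverse (1 + of_real b * z)
        = (of_real c + of_real (t + b * c) * z) / (1 + of_real b * z)"
      using ne[of z] z by (simp add: field_simps)
    moreover have "cmod (of_real c + of_real (t + b * c) * z) \<le> cmod (1 + of_real b * z)"
      using assms z by (intro moebius_cmod_le_1)
    ultimately have "cmod (complex_of_real c + of_real t * z * inverse (1 + of_real b * z)) \<le> 1"
      using ne[of z] z by (simp add: norm_divide)
    then show ?thesis
      by (simp add: h_def norm_power power_le_one)
  qed
  have "cmod ((deriv ^^ k) h 0) \<le> fact k * 1 / R ^ k"
    using bound by (intro Cauchy_inequality hol cont R)
  then have "cmod ((deriv ^^ k) h 0 / fact k) \<le> 1 / R ^ k"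
    by (simp add: norm_divide divide_le_eq mult.commute)
  then show "\<bar>moebius_coeff c b t n k\<bar> \<le> 1 / R ^ k"
    unfolding coeff by simp
  assume x: "\<bar>x\<bar> < R"
  have "(\<lambda>k. (deriv ^^ k) h 0 / fact k * (of_real x - 0) ^ k) sums h (of_real x)"
    using x by (intro holomorphic_power_series[OF hol]) simp
  then have "(\<lambda>k. complex_of_real (moebius_coeff c b t n k * x ^ k)) sums
      of_real ((c + t * x / (1 + b * x)) ^ n)"
    unfolding coeff by (simp add: h_def divide_inverse)
  then show "(\<lambda>k. moebius_coeff c b t n k * x ^ k) sums ((c + t * x / (1 + b * x)) ^ n)"
    by (simp only: sums_of_real_iff)
qed

section \<open>The transfer operator and its truncation\<close>

lemma f_0_eq: "f_0 A = F A $ 1 $ 2 / F A $ 2 $ 2"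
  by (simp add: f_0_def moebius_def)

lemma f_transpose_0_eq: "f_transpose_0 A = F A $ 2 $ 1 / F A $ 2 $ 2"
  by (simp add: f_transpose_0_def moebius_def transpose_def)

lemma f_deriv_0_eq:
  assumes "F A $ 2 $ 2 \<noteq> 0"
  shows "f_deriv_0 A = det (F A) / (F A $ 2 $ 2)\<^sup>2"
proof -
  have "(moebius (F A) has_field_derivative det (F A) / (F A $ 2 $ 2)\<^sup>2) (at 0)"
    unfolding moebius_def [abs_def] using assms
    by (auto intro!: derivative_eq_intros simp: det_2 power2_eq_square)
  then show ?thesis
    unfolding f_deriv_0_def by (rule DERIV_imp_deriv)
qed

lemma F_entries:
  "F A $ 1 $ 1 = (A $ 1 $ 1 - A $ 1 $ 2 - A $ 2 $ 1 + A $ 2 $ 2) / 2"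
  "F A $ 1 $ 2 = (A $ 1 $ 1 + A $ 1 $ 2 - A $ 2 $ 1 - A $ 2 $ 2) / 2"
  "F A $ 2 $ 1 = (A $ 1 $ 1 - A $ 1 $ 2 + A $ 2 $ 1 - A $ 2 $ 2) / 2"
  "F A $ 2 $ 2 = (A $ 1 $ 1 + A $ 1 $ 2 + A $ 2 $ 1 + A $ 2 $ 2) / 2"
  by (simp_all add: F_def Let_def)

lemma det_F: "det (F A) = det A"
  by (simp add: det_2 F_entries field_simps)

lemma sums_tail_geometric:
  fixes f :: "nat \<Rightarrow> real"
  assumes "f sums s" "\<And>k. \<bar>f k\<bar> \<le> H * q ^ k" "0 \<le> q" "q < 1"
  shows "\<bar>s - (\<Sum>k<M. f k)\<bar> \<le> H * q ^ M / (1 - q)"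
proof -
  have g: "(\<lambda>k. H * q ^ M * q ^ k) sums (H * q ^ M * (1 / (1 - q)))"
    using assms by (intro sums_mult geometric_sums) auto
  have "(\<lambda>k. f (k + M)) sums (s - (\<Sum>k<M. f k))"
    using assms(1) by (rule sums_split_initial_segment)
  then have "\<bar>s - (\<Sum>k<M. f k)\<bar> = norm (\<Sum>k. f (k + M))"
    by (simp add: sums_iff)
  also have "\<dots> \<le> (\<Sum>k. H * q ^ M * q ^ k)"
  proof (rule norm_suminf_le)
    show "norm (f (k + M)) \<le> H * q ^ M * q ^ k" for k
      using assms(2)[of "k + M"] by (simp add: power_add mult_ac)
  qed (use g in \<open>simp add: sums_iff\<close>)
  finally show ?thesis
    using g by (simp add: sums_iff)
qed

section \<open>Iterates of the truncated matrix\<close>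

primrec truncated_iterate ::
  "('i::finite \<Rightarrow> real^2^2) \<Rightarrow> ('i \<Rightarrow> real) \<Rightarrow> nat \<Rightarrow> nat \<Rightarrow> nat \<Rightarrow> real" where
  "truncated_iterate A w M 0 k = v_vec A w k"
| "truncated_iterate A w M (Suc n) k =
     (\<Sum>m<M. T_entry A w k m * truncated_iterate A w M n m)"

text \<open>Matrix powers receive new factors on the right, while the iteration of a vector applies
  them on the left.\<close>

lemma pow_mat_mult_commute:
  assumes "T \<in> carrier_mat M M"
  shows "T ^\<^sub>m n * T = T * T ^\<^sub>m n"
proof (induction n)
  case (Suc n)
  then show ?case
    using assms by (simp add: assoc_mult_mat[of _ M M _ M _ M])
qed (use assms in simp)

lemma T_trunc_power_v_trunc:
  "(T_trunc A w M ^\<^sub>m n) *\<^sub>v v_trunc A w M = Matrix.vec M (truncated_iterate A w M n)"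
proof (induction n)
  case 0
  show ?case by (intro eq_vecI) (simp_all add: v_trunc_def T_trunc_def)
next
  case (Suc n)
  have T: "T_trunc A w M \<in> carrier_mat M M" and v: "v_trunc A w M \<in> carrier_vec M"
    by (simp_all add: T_trunc_def v_trunc_def)
  have "(T_trunc A w M ^\<^sub>m Suc n) *\<^sub>v v_trunc A w M
      = T_trunc A w M *\<^sub>v ((T_trunc A w M ^\<^sub>m n) *\<^sub>v v_trunc A w M)"
    using T v by (simp add: pow_mat_mult_commute[OF T] assoc_mult_mat_vec[of _ M M _ M])
  also have "\<dots> = Matrix.vec M (truncated_iterate A w M (Suc n))"
    unfolding Suc
    by (intro eq_vecI) (simp_all add: T_trunc_def scalar_prod_def atLeast0LessThan)
  finally show ?case .
qed

lemma lyapunov_approx_eq: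
  assumes "1 \<le> M"
  shows "lyapunov_approx A w N M = (\<Sum>n<N. truncated_iterate A w M n 0)"
  using assms by (simp add: lyapunov_approx_def T_trunc_power_v_trunc)

lemma T_entry_eq:
  "T_entry A w k n = (if n = 0 then 0 else
     (\<Sum>i\<in>UNIV. w i * moebius_coeff (f_transpose_0 (A i)) (f_0 (A i)) (f_deriv_0 (A i)) n k))"
  by (simp add: T_entry_def moebius_coeff_def)

text \<open>Inverse of the coordinate (a - b)/(a + b), normalised to entry sum 1. With this
  normalisation the entry sum of an image vector is exactly its scaling factor.\<close>

definition direction :: "real \<Rightarrow> real^2" where
  "direction x = vector [(1 + x) / 2, (1 - x) / 2]"

lemma positive_vector_direction: "\<bar>x\<bar> < 1 \<Longrightarrow> positive_vector (direction x)"
  by (auto simp: positive_vector_def direction_def forall_2)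

section \<open>The transposed maps in the disc coordinate\<close>

locale positive_invertible_family = positive_family +
  assumes A_invertible: "\<And>i. invertible (A i)"
begin

abbreviation "b i \<equiv> f_0 (A i)"
abbreviation "c i \<equiv> f_transpose_0 (A i)"
abbreviation "t i \<equiv> f_deriv_0 (A i)"
abbreviation "\<delta> i \<equiv> F (A i) $ 2 $ 2"

definition g :: "'a \<Rightarrow> real \<Rightarrow> real" where
  "g i x = c i + t i * x / (1 + b i * x)"

lemma \<delta>_pos: "\<delta> i > 0"
  using entry_pos[of i] by (simp add: F_entries add_pos_pos)

lemma t_plus_bc: "t i + b i * c i = F (A i) $ 1 $ 1 / \<delta> i"
  using \<delta>_pos[of i]
  by (simp add: f_0_eq f_transpose_0_eq f_deriv_0_eq det_2 power2_eq_square field_simps)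

text \<open>Multiplied by \<open>\<delta> i\<close>, the first two inequalities say
  \<open>\<bar>p - q\<bar> < p + q\<close> for the two rows (p, q) of \<open>A i\<close>. Their
  strictness leaves room for a radius beyond 1.\<close>

lemma moebius_bounds:
  "\<bar>c i + (t i + b i * c i)\<bar> < 1 + b i" "\<bar>c i - (t i + b i * c i)\<bar> < 1 - b i" "\<bar>b i\<bar> < 1"
proof -
  note pos = entry_pos[of i 1 1] entry_pos[of i 1 2] entry_pos[of i 2 1] entry_pos[of i 2 2]
  have eqs: "c i + (t i + b i * c i) = (A i $ 1 $ 1 - A i $ 1 $ 2) / \<delta> i"
    "c i - (t i + b i * c i) = (A i $ 2 $ 1 - A i $ 2 $ 2) / \<delta> i"
    "1 + b i = (A i $ 1 $ 1 + A i $ 1 $ 2) / \<delta> i"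
    "1 - b i = (A i $ 2 $ 1 + A i $ 2 $ 2) / \<delta> i"
    using \<delta>_pos[of i] unfolding t_plus_bc
    by (simp_all add: f_0_eq f_transpose_0_eq F_entries divide_simps)
      (simp_all add: algebra_simps)
  have "\<bar>A i $ 1 $ 1 - A i $ 1 $ 2\<bar> < A i $ 1 $ 1 + A i $ 1 $ 2"
    "\<bar>A i $ 2 $ 1 - A i $ 2 $ 2\<bar> < A i $ 2 $ 1 + A i $ 2 $ 2"
    using pos by linarith+
  from this[THEN divide_strict_right_mono, OF \<delta>_pos[of i]]
  show "\<bar>c i + (t i + b i * c i)\<bar> < 1 + b i" "\<bar>c i - (t i + b i * c i)\<bar> < 1 - b i"
    unfolding eqs abs_divide using \<delta>_pos[of i] by simp_all
  have "0 < 1 + b i" "0 < 1 - b i"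
    unfolding eqs using \<delta>_pos[of i] pos by (auto intro!: divide_pos_pos add_pos_pos)
  then show "\<bar>b i\<bar> < 1" by linarith
qed

lemma one_plus_b_pos:
  assumes "\<bar>x\<bar> < 1" shows "0 < 1 + b i * x"
proof -
  have "\<bar>b i * x\<bar> < 1"
    using moebius_bounds(3)[of i] assms by (simp add: abs_mult abs_mult_less[of _ 1 _ 1, simplified])
  then show ?thesis by linarith
qed

text \<open>Splits the action into direction and size. The direction moves by \<open>g i\<close>,
  and the logarithm of the size is the function whose Taylor coefficients make up
  \<open>v_vec\<close>.\<close>

lemma transpose_mult_direction:
  assumes "\<bar>x\<bar> < 1"
  shows "tr (A i) *v direction x = (\<delta> i * (1 + b i * x)) *\<^sub>R direction (g i x)"
proof -
  have ne: "1 + b i * x \<noteq> 0" "\<delta> i \<noteq> 0"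
    using one_plus_b_pos[OF assms, of i] \<delta>_pos[of i] by simp_all
  have "g i x * (1 + b i * x) = c i * (1 + b i * x) + t i * x"
    using ne(1) by (simp add: g_def distrib_right)
  then have "g i x * (1 + b i * x) = c i + (t i + b i * c i) * x"
    by (simp add: algebra_simps)
  then have "\<delta> i * (g i x * (1 + b i * x)) = \<delta> i * (c i + F (A i) $ 1 $ 1 / \<delta> i * x)"
    unfolding t_plus_bc by simp
  also have "\<dots> = F (A i) $ 2 $ 1 + F (A i) $ 1 $ 1 * x"
    using ne(2) by (simp add: f_transpose_0_eq distrib_left)
  finally have g: "\<delta> i * (1 + b i * x) * g i x = F (A i) $ 2 $ 1 + F (A i) $ 1 $ 1 * x"
    by (simp only: mult.assoc mult.commute[of "g i x"])
  have d: "\<delta> i * (1 + b i * x) = F (A i) $ 2 $ 2 + F (A i) $ 1 $ 2 * x"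
    using ne(2) by (simp add: f_0_eq distrib_left)
  have half: "(a *\<^sub>R direction y) $ 1 = (a + a * y) / 2" "(a *\<^sub>R direction y) $ 2 = (a - a * y) / 2"
    for a y by (simp_all add: direction_def distrib_left right_diff_distrib)
  have comp: "(tr (A i) *v direction x) $ 1 = (A i $ 1 $ 1 * (1 + x) + A i $ 2 $ 1 * (1 - x)) / 2"
    "(tr (A i) *v direction x) $ 2 = (A i $ 1 $ 2 * (1 + x) + A i $ 2 $ 2 * (1 - x)) / 2"
    unfolding matrix_vector_mult_def sum_2 transpose_def direction_def
    by (simp_all add: add_divide_distrib)
  show ?thesis
    unfolding Finite_Cartesian_Product.vec_eq_iff forall_2 half comp g unfolding d unfolding F_entries
    by (simp add: field_simps)
qed

lemma g_less_1:
  assumes "\<bar>x\<bar> < 1" shows "\<bar>g i x\<bar> < 1"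
proof -
  interpret dual: positive_family "\<lambda>i. tr (A i)" w by (rule transpose_positive_family)
  have "positive_vector ((\<delta> i * (1 + b i * x)) *\<^sub>R direction (g i x))"
    using dual.positive_vector_mult[OF positive_vector_direction[OF assms], of i]
    unfolding transpose_mult_direction[OF assms] .
  moreover have "0 < \<delta> i * (1 + b i * x)"
    using \<delta>_pos one_plus_b_pos[OF assms] by simp
  ultimately have "positive_vector (direction (g i x))"
    by (simp add: positive_vector_def zero_less_mult_iff)
  then show ?thesis
    by (auto simp: positive_vector_def direction_def forall_2)
qed

lemma mean_log_scaleR:
  assumes "positive_vector u" "positive_vector v" "0 < a"
  shows "mean_log A w n u (a *\<^sub>R v) = mean_log A w n u v + ln a"
proof (rule antisym)
  have av: "positive_vector (a *\<^sub>R v)" using assms by (simp add: positive_vector_def)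
  show "mean_log A w n u (a *\<^sub>R v) \<le> mean_log A w n u v + ln a"
    using assms av by (intro mean_log_mono_scale) auto
  have "mean_log A w n u v \<le> mean_log A w n u (a *\<^sub>R v) + ln (1 / a)"
    using assms av by (intro mean_log_mono_scale) auto
  then show "mean_log A w n u v + ln a \<le> mean_log A w n u (a *\<^sub>R v)"
    using assms by (simp add: ln_div)
qed

lemma transpose_positive_invertible_family:
  "positive_invertible_family (\<lambda>i. tr (A i)) w"
  using transpose_positive_family A_invertible
  by (simp add: positive_invertible_family_def positive_invertible_family_axioms_def
      invertible_det_nz)

lemma mean_incr_scaleR:
  assumes "positive_vector u" "positive_vector v" "0 < a"
  shows "mean_incr A w n u (a *\<^sub>R v) = mean_incr A w n u v"
  using assms by (simp add: mean_incr_def mean_log_scaleR del: mean_log.simps)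

section \<open>Functions represented by the iterates\<close>

text \<open>$\Phi_n = L^n \Phi_0$, where $L h = \sum_i w_i\, h \circ g_i$ and $v$ lists the Taylor
  coefficients of $\Phi_0$.\<close>

definition \<Phi> :: "nat \<Rightarrow> real \<Rightarrow> real" where
  "\<Phi> n x = mean_incr (\<lambda>i. tr (A i)) w n 1 (direction x)"

lemma \<Phi>_Suc:
  assumes "\<bar>x\<bar> < 1" shows "\<Phi> (Suc n) x = (\<Sum>i\<in>UNIV. w i * \<Phi> n (g i x))"
proof -
  interpret dual: positive_invertible_family "\<lambda>i. tr (A i)" w
    by (rule transpose_positive_invertible_family)
  show ?thesis
    unfolding \<Phi>_def mean_incr_Suc transpose_mult_direction[OF assms]
    using \<delta>_pos one_plus_b_pos[OF assms] g_less_1[OF assms]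
    by (intro sum.cong refl arg_cong2[where f = "(*)"] dual.mean_incr_scaleR)
      (auto intro: positive_vector_direction)
qed

lemma \<Phi>_0:
  assumes "\<bar>x\<bar> < 1" shows "\<Phi> 0 x = (\<Sum>i\<in>UNIV. w i * (ln (\<delta> i) + ln (1 + b i * x)))"
proof -
  have one: "1 \<bullet> direction y = 1" for y
    by (simp add: direction_def inner_vec_def sum_2 field_simps)
  show ?thesis
    unfolding \<Phi>_def mean_incr_def mean_log.simps transpose_mult_direction[OF assms] inner_scaleR_right one
    using \<delta>_pos one_plus_b_pos[OF assms] by (auto intro!: sum.cong simp: ln_mult_pos)
qed

lemma \<Phi>_at_0: "\<Phi> n 0 = mean_incr A w n 1 1"
proof -
  interpret dual: positive_invertible_family "\<lambda>i. tr (A i)" w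
    by (rule transpose_positive_invertible_family)
  have "direction 0 = (1/2) *\<^sub>R 1"
    unfolding Finite_Cartesian_Product.vec_eq_iff forall_2 by (simp add: direction_def)
  then have "\<Phi> n 0 = mean_incr (\<lambda>i. tr (A i)) w n 1 1"
    by (simp add: \<Phi>_def dual.mean_incr_scaleR)
  then show ?thesis by (simp add: mean_incr_transpose)
qed

text \<open>The derivative at 0 is the determinant divided by the square of
  \<open>\<delta> i\<close>, so the given logarithm is half that of a square. Invertibility lets the
  determinant cancel.\<close>

lemma v_vec_0: "v_vec A w 0 = (\<Sum>i\<in>UNIV. w i * ln (\<delta> i))"
proof -
  have "1/2 * ln (det (F (A i)) / t i) = ln (\<delta> i)" for i
  proof -
    have "det (F (A i)) \<noteq> 0"
      using A_invertible[of i] by (simp add: det_F invertible_det_nz)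
    then have "det (F (A i)) / t i = (\<delta> i)\<^sup>2"
      using \<delta>_pos[of i] by (simp add: f_deriv_0_eq)
    then show ?thesis
      using \<delta>_pos[of i] by (simp add: ln_realpow)
  qed
  then show ?thesis by (simp add: v_vec_def v_seq_def)
qed

lemma v_vec_sums:
  assumes "\<bar>x\<bar> < 1" shows "(\<lambda>k. v_vec A w k * x ^ k) sums \<Phi> 0 x"
proof -
  have "(\<lambda>k. w i * (v_seq (b i) (ln (\<delta> i)) k * x ^ k)) sums (w i * (ln (\<delta> i) + ln (1 + b i * x)))" for i
  proof (rule sums_mult)
    have "\<bar>b i * x\<bar> < 1"
      using moebius_bounds(3)[of i] assms by (simp add: abs_mult abs_mult_less[of _ 1 _ 1, simplified])
    then have "(\<lambda>k. - ((- (b i * x)) ^ k) / real k) sums ln (1 + b i * x)"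
      by (rule ln_series')
    \<comment> \<open>The term k = 0 of the logarithm series is a division by zero, hence 0; the
      constant term is supplied separately.\<close>
    moreover have "(\<lambda>k. if k = 0 then ln (\<delta> i) else 0) sums ln (\<delta> i)"
      by (rule sums_single)
    ultimately have "(\<lambda>k. (if k = 0 then ln (\<delta> i) else 0) + - ((- (b i * x)) ^ k) / real k) sums
        (ln (\<delta> i) + ln (1 + b i * x))"
      by (intro sums_add)
    moreover have "(if k = 0 then ln (\<delta> i) else 0) + - ((- (b i * x)) ^ k) / real k
        = v_seq (b i) (ln (\<delta> i)) k * x ^ k" for k
    proof -
      have "(- (b i * x)) ^ k = (- b i) ^ k * x ^ k"
        unfolding power_mult_distrib[symmetric] by simp
      then show ?thesis by (simp add: v_seq_def)
    qed
    ultimately show "(\<lambda>k. v_seq (b i) (ln (\<delta> i)) k * x ^ k) sums (ln (\<delta> i) + ln (1 + b i * x))"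
      by simp
  qed
  then have "(\<lambda>k. \<Sum>i\<in>UNIV. w i * (v_seq (b i) (ln (\<delta> i)) k * x ^ k)) sums \<Phi> 0 x"
    unfolding \<Phi>_0[OF assms] by (intro sums_sum)
  moreover have "(\<Sum>i\<in>UNIV. w i * (v_seq (b i) (ln (\<delta> i)) k * x ^ k)) = v_vec A w k * x ^ k" for k
  proof (cases "k = 0")
    case True
    then show ?thesis by (simp add: v_vec_0 v_seq_def)
  next
    case False
    then show ?thesis by (simp add: v_vec_def v_seq_def sum_distrib_right mult.assoc)
  qed
  ultimately show ?thesis by simp
qed

text \<open>At R = 1 the inequalities hold strictly by \<open>moebius_bounds\<close>. By continuity,
  and because the family is finite, they survive slightly to the right of 1.\<close>

lemma analytic_radius:
  obtains R where "R > 1"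
    "\<And>i. \<bar>b i\<bar> * R < 1" "\<And>i. \<bar>c i + (t i + b i * c i) * R\<bar> \<le> 1 + b i * R"
    "\<And>i. \<bar>c i - (t i + b i * c i) * R\<bar> \<le> 1 - b i * R"
proof -
  have "\<forall>\<^sub>F R in at_right 1. \<forall>i. \<bar>b i\<bar> * R < 1 \<and> \<bar>c i + (t i + b i * c i) * R\<bar> \<le> 1 + b i * R \<and>
      \<bar>c i - (t i + b i * c i) * R\<bar> \<le> 1 - b i * R"
  proof (rule eventually_all_finite)
    fix i
    let ?e = "t i + b i * c i"
    have lim: "((\<lambda>R. \<bar>b i\<bar> * R) \<longlongrightarrow> \<bar>b i\<bar> * 1) (at_right 1)"
      "((\<lambda>R. 1 + b i * R - \<bar>c i + ?e * R\<bar>) \<longlongrightarrow> 1 + b i * 1 - \<bar>c i + ?e * 1\<bar>) (at_right 1)"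
      "((\<lambda>R. 1 - b i * R - \<bar>c i - ?e * R\<bar>) \<longlongrightarrow> 1 - b i * 1 - \<bar>c i - ?e * 1\<bar>) (at_right 1)"
      by (intro tendsto_intros)+
    have "\<forall>\<^sub>F R in at_right 1. \<bar>b i\<bar> * R < 1"
      "\<forall>\<^sub>F R in at_right 1. 0 < 1 + b i * R - \<bar>c i + ?e * R\<bar>"
      "\<forall>\<^sub>F R in at_right 1. 0 < 1 - b i * R - \<bar>c i - ?e * R\<bar>"
      using order_tendstoD(2)[OF lim(1), of 1] order_tendstoD(1)[OF lim(2), of 0]
        order_tendstoD(1)[OF lim(3), of 0] moebius_bounds[of i] by simp_all
    then show "\<forall>\<^sub>F R in at_right 1. \<bar>b i\<bar> * R < 1 \<and> \<bar>c i + ?e * R\<bar> \<le> 1 + b i * R \<and>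
        \<bar>c i - ?e * R\<bar> \<le> 1 - b i * R"
      by eventually_elim auto
  qed
  then have "\<forall>\<^sub>F R in at_right 1. 1 < R \<and> (\<forall>i. \<bar>b i\<bar> * R < 1 \<and>
      \<bar>c i + (t i + b i * c i) * R\<bar> \<le> 1 + b i * R \<and> \<bar>c i - (t i + b i * c i) * R\<bar> \<le> 1 - b i * R)"
    by (intro eventually_conj eventually_at_right_less)
  from eventually_happens'[OF trivial_limit_at_right_real this]
  obtain R where "1 < R \<and> (\<forall>i. \<bar>b i\<bar> * R < 1 \<and>
      \<bar>c i + (t i + b i * c i) * R\<bar> \<le> 1 + b i * R \<and> \<bar>c i - (t i + b i * c i) * R\<bar> \<le> 1 - b i * R)"
    by (elim exE)
  then show ?thesis
    by (intro that[of R]) simp_all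
qed

section \<open>Action of the infinite matrix on functions, and the truncation error\<close>

text \<open>The function represented by $T^n v$: the matrix $T$ acts as $h \mapsto L h - h(0)$, its column $0$
  being zero.\<close>

fun \<Psi> :: "nat \<Rightarrow> real \<Rightarrow> real" where
  "\<Psi> 0 x = \<Phi> 0 x"
| "\<Psi> (Suc n) x = \<Phi> (Suc n) x - \<Phi> n 0"

lemma \<Psi>_Suc:
  assumes "\<bar>x\<bar> < 1" shows "\<Psi> (Suc n) x = (\<Sum>i\<in>UNIV. w i * \<Psi> n (g i x)) - \<Psi> n 0"
  by (cases n) (simp_all add: \<Phi>_Suc[OF assms] right_diff_distrib sum_subtractf mean_const)

lemma sum_\<Psi>: "(\<Sum>n<Suc N. \<Psi> n 0) = \<Phi> N 0"
  by (induction N) simp_all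

text \<open>Image of the monomial x^m under h |-> L h - h(0). For m = 0 it vanishes because L fixes
  constants; for m > 0 there is nothing to subtract.\<close>

definition image_power :: "nat \<Rightarrow> real \<Rightarrow> real" where
  "image_power m x = (if m = 0 then 0 else \<Sum>i\<in>UNIV. w i * g i x ^ m)"

lemma T_entry_sums:
  assumes "\<bar>x\<bar> < 1"
  shows "(\<lambda>k. T_entry A w k m * x ^ k) sums image_power m x"
proof -
  obtain R where R: "R > 1"
    "\<And>i. \<bar>b i\<bar> * R < 1" "\<And>i. \<bar>c i + (t i + b i * c i) * R\<bar> \<le> 1 + b i * R"
    "\<And>i. \<bar>c i - (t i + b i * c i) * R\<bar> \<le> 1 - b i * R"
    by (rule analytic_radius) (rule that; assumption)
  have "(\<lambda>k. \<Sum>i\<in>UNIV. w i * (moebius_coeff (c i) (b i) (t i) m k * x ^ k)) sums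
      (\<Sum>i\<in>UNIV. w i * g i x ^ m)"
    unfolding g_def using R assms
    by (intro sums_sum sums_mult moebius_coeff_sums[where R = R]) auto
  then show ?thesis
    by (auto simp: T_entry_eq image_power_def sum_distrib_right mult.assoc)
qed

text \<open>The induction runs over all x at once, since a step evaluates the previous error at the
  points \<open>g i x\<close> and at 0. The third contribution is the tail of the column series
  beyond M.\<close>

lemma truncation_error:
  obtains V q B :: real where "0 < V" "0 < q" "q < 1" "3 \<le> B"
    "\<And>M n x. 1 \<le> M \<Longrightarrow> \<bar>x\<bar> < 1 \<Longrightarrow>
       \<bar>(\<Sum>k<M. truncated_iterate A w M n k * x ^ k) - \<Psi> n x\<bar> \<le> V * q ^ M * B ^ Suc n"
proof -
  obtain R where R: "R > 1"
    "\<And>i. \<bar>b i\<bar> * R < 1" "\<And>i. \<bar>c i + (t i + b i * c i) * R\<bar> \<le> 1 + b i * R"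
    "\<And>i. \<bar>c i - (t i + b i * c i) * R\<bar> \<le> 1 - b i * R"
    by (rule analytic_radius) (rule that; assumption)
  define q where "q = 1 / R"
  define K where "K = 1 / (1 - q)"
  define V where "V = max 1 \<bar>v_vec A w 0\<bar>"
  \<comment> \<open>One step multiplies the error by at most K from the cut columns, 1 from
    averaging over the \<open>g i x\<close>, and 1 from the subtracted value at 0.\<close>
  define B where "B = K + 2"
  have q: "0 < q" "q < 1" using R(1) by (simp_all add: q_def)
  have K: "1 \<le> K" using q by (simp add: K_def)
  have V: "1 \<le> V" by (simp add: V_def)
  have B: "3 \<le> B" "K \<le> B" using K by (simp_all add: B_def)
  have T_bound: "\<bar>T_entry A w k m\<bar> \<le> q ^ k" for k m
  proof (cases "m = 0")
    case True
    then show ?thesis using q by (simp add: T_entry_eq)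
  next
    case False
    have "\<bar>moebius_coeff (c i) (b i) (t i) m k\<bar> \<le> q ^ k" for i
      using moebius_coeff_bound[where R = R and c = "c i" and b = "b i" and t = "t i" and n = m and k = k] R
      by (simp add: q_def power_one_over)
    then have "\<bar>(\<Sum>i\<in>UNIV. w i * moebius_coeff (c i) (b i) (t i) m k) - (\<Sum>i\<in>UNIV. w i * 0)\<bar> \<le> q ^ k"
      by (intro mean_abs_diff_le) simp
    then show ?thesis using False by (simp add: T_entry_eq)
  qed
  have v_bound: "\<bar>v_vec A w k\<bar> \<le> V * q ^ k" for k
  proof (cases "k = 0")
    case True
    then show ?thesis by (simp add: V_def)
  next
    case False
    have "\<bar>v_seq (b i) 0 k\<bar> \<le> q ^ k" for i
    proof -
      have "\<bar>b i\<bar> \<le> q"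
        using R(1) R(2)[of i] by (simp add: q_def field_simps)
      then have "\<bar>b i\<bar> ^ k / real k \<le> q ^ k / 1"
        using False q by (intro frac_le power_mono) auto
      then show ?thesis
        using False by (simp add: v_seq_def abs_divide power_abs)
    qed
    then have "\<bar>(\<Sum>i\<in>UNIV. w i * v_seq (b i) 0 k) - (\<Sum>i\<in>UNIV. w i * 0)\<bar> \<le> q ^ k"
      by (intro mean_abs_diff_le) simp
    then have "\<bar>v_vec A w k\<bar> \<le> 1 * q ^ k"
      using False by (simp add: v_vec_def v_seq_def)
    also have "\<dots> \<le> V * q ^ k"
      using V q by (intro mult_right_mono) auto
    finally show ?thesis .
  qed
  have gp: "(\<Sum>k<M. q ^ k) \<le> K" for M
    using q by (simp add: K_def sum_gp_strict divide_right_mono)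
  \<comment> \<open>Row k of \<open>T\<close> is at most q^k in every column, so each iterate takes
    its decay in k from the last application of \<open>T\<close>. Summation over the columns costs a
    factor K.\<close>
  have it_bound: "\<bar>truncated_iterate A w M n k\<bar> \<le> V * K ^ n * q ^ k" for M n k
  proof (induction n arbitrary: k)
    case 0
    then show ?case using v_bound by simp
  next
    case (Suc n)
    have "\<bar>truncated_iterate A w M (Suc n) k\<bar> \<le> (\<Sum>m<M. \<bar>T_entry A w k m * truncated_iterate A w M n m\<bar>)"
      by (simp add: sum_abs)
    also have "\<dots> \<le> (\<Sum>m<M. q ^ k * (V * K ^ n * q ^ m))"
      unfolding abs_mult using q by (intro sum_mono mult_mono T_bound Suc) auto
    also have "\<dots> = q ^ k * (V * K ^ n * (\<Sum>m<M. q ^ m))"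
      by (simp add: sum_distrib_left)
    also have "\<dots> \<le> q ^ k * (V * K ^ n * K)"
      using q V K gp by (intro mult_left_mono) auto
    finally show ?case by (simp add: mult_ac)
  qed
  have error: "\<bar>(\<Sum>k<M. truncated_iterate A w M n k * x ^ k) - \<Psi> n x\<bar> \<le> V * q ^ M * B ^ Suc n"
    if M: "1 \<le> M" and x: "\<bar>x\<bar> < 1" for M n x
    using x
  proof (induction n arbitrary: x)
    case 0
    have "\<bar>v_vec A w k * x ^ k\<bar> \<le> V * q ^ k" for k
    proof -
      have "\<bar>v_vec A w k\<bar> * \<bar>x ^ k\<bar> \<le> (V * q ^ k) * 1"
        using 0 V q v_bound by (intro mult_mono) (auto simp: power_abs power_le_one)
      then show ?thesis by (simp add: abs_mult)
    qed
    then have "\<bar>\<Phi> 0 x - (\<Sum>k<M. v_vec A w k * x ^ k)\<bar> \<le> V * q ^ M / (1 - q)"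
      using q by (intro sums_tail_geometric v_vec_sums 0) auto
    also have "\<dots> = V * q ^ M * K"
      by (simp add: K_def)
    also have "\<dots> \<le> V * q ^ M * B"
      using V q B by (intro mult_left_mono) auto
    finally show ?case by (simp add: abs_minus_commute)
  next
    case (Suc n)
    let ?a = "truncated_iterate A w M n"
    let ?U = "\<lambda>x. \<Sum>k<M. ?a k * x ^ k"
    let ?P = "\<lambda>m. \<Sum>k<M. T_entry A w k m * x ^ k"
    have tail: "\<bar>image_power m x - ?P m\<bar> \<le> K * q ^ M" for m
    proof -
      have "\<bar>T_entry A w k m * x ^ k\<bar> \<le> 1 * q ^ k" for k
      proof -
        have "\<bar>T_entry A w k m\<bar> * \<bar>x ^ k\<bar> \<le> q ^ k * 1"
          using Suc.prems q T_bound by (intro mult_mono) (auto simp: power_abs power_le_one)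
        then show ?thesis by (simp add: abs_mult)
      qed
      then have "\<bar>image_power m x - ?P m\<bar> \<le> 1 * q ^ M / (1 - q)"
        using q by (intro sums_tail_geometric T_entry_sums Suc.prems) auto
      then show ?thesis by (simp add: K_def)
    qed
    \<comment> \<open>As a function of x, the new iterate combines the column series of
      \<open>T\<close> cut at M.\<close>
    have new: "(\<Sum>k<M. truncated_iterate A w M (Suc n) k * x ^ k) = (\<Sum>m<M. ?a m * ?P m)"
    proof -
      have "(\<Sum>k<M. truncated_iterate A w M (Suc n) k * x ^ k)
          = (\<Sum>k<M. \<Sum>m<M. ?a m * (T_entry A w k m * x ^ k))"
        by (simp add: sum_distrib_right sum_distrib_left mult_ac)
      also have "\<dots> = (\<Sum>m<M. \<Sum>k<M. ?a m * (T_entry A w k m * x ^ k))"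
        by (rule sum.swap)
      finally show ?thesis by (simp add: sum_distrib_left)
    qed
    have U0: "?U 0 = ?a 0"
      using M by (cases M) (simp_all add: sum.lessThan_Suc_shift)
    \<comment> \<open>The exact operator applied to the polynomial \<open>?U\<close> uses the same
      coefficients with uncut columns. Its term m = 0 cancels against \<open>?U 0\<close> because
      the weights sum to 1.\<close>
    have transfer: "(\<Sum>i\<in>UNIV. w i * ?U (g i x)) - ?U 0 = (\<Sum>m<M. ?a m * image_power m x)"
    proof -
      have "(\<Sum>i\<in>UNIV. w i * ?U (g i x)) = (\<Sum>m<M. ?a m * (\<Sum>i\<in>UNIV. w i * g i x ^ m))"
        unfolding sum_distrib_left by (subst sum.swap) (simp add: mult_ac)
      moreover obtain M' where M': "M = Suc M'"
        using M by (cases M) auto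
      ultimately show ?thesis
        unfolding U0 unfolding M' sum.lessThan_Suc_shift by (simp add: image_power_def w_sum)
    qed
    have "\<bar>(\<Sum>m<M. ?a m * image_power m x) - (\<Sum>m<M. ?a m * ?P m)\<bar>
        \<le> (\<Sum>m<M. \<bar>?a m\<bar> * \<bar>image_power m x - ?P m\<bar>)"
      unfolding sum_subtractf[symmetric] right_diff_distrib[symmetric] abs_mult[symmetric]
      by (rule sum_abs)
    also have "\<dots> \<le> (\<Sum>m<M. (V * K ^ n * q ^ m) * (K * q ^ M))"
      using V K q by (intro sum_mono mult_mono it_bound tail) auto
    also have "\<dots> = V * K ^ n * (K * q ^ M) * (\<Sum>m<M. q ^ m)"
      by (simp add: sum_distrib_left mult_ac)
    also have "\<dots> \<le> V * K ^ n * (K * q ^ M) * K"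
      using V K q gp by (intro mult_left_mono) auto
    also have "\<dots> = V * q ^ M * K ^ Suc n * K"
      by (simp add: mult_ac)
    also have "\<dots> \<le> V * q ^ M * B ^ Suc n * K"
      using V K q B by (intro mult_right_mono mult_left_mono power_mono) auto
    finally have e1: "\<bar>(\<Sum>m<M. ?a m * image_power m x) - (\<Sum>m<M. ?a m * ?P m)\<bar>
        \<le> V * q ^ M * B ^ Suc n * K" .
    have e2: "\<bar>(\<Sum>i\<in>UNIV. w i * ?U (g i x)) - (\<Sum>i\<in>UNIV. w i * \<Psi> n (g i x))\<bar> \<le> V * q ^ M * B ^ Suc n"
      by (intro mean_abs_diff_le Suc.IH g_less_1 Suc.prems)
    have e3: "\<bar>?U 0 - \<Psi> n 0\<bar> \<le> V * q ^ M * B ^ Suc n"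
      by (rule Suc.IH) simp
    have "\<bar>(\<Sum>k<M. truncated_iterate A w M (Suc n) k * x ^ k) - \<Psi> (Suc n) x\<bar>
        \<le> V * q ^ M * B ^ Suc n * K + V * q ^ M * B ^ Suc n + V * q ^ M * B ^ Suc n"
      unfolding new \<Psi>_Suc[OF Suc.prems] using e1 e2 e3 transfer by linarith
    also have "\<dots> = V * q ^ M * B ^ Suc (Suc n)"
      by (simp add: B_def algebra_simps)
    finally show ?case .
  qed
  have "0 < V" using V by simp
  show ?thesis
    by (rule that[OF \<open>0 < V\<close> q B(1) error])
qed

text \<open>The exact summands with n < N telescope to increment number N - 1, which explains the
  exponent of \<open>\<theta>\<close>. The truncation errors grow geometrically, and since B is at
  least 2 their sum stays below the next power of B.\<close>

lemma lyapunov_approx_error: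
  obtains C \<theta> V q B :: real where "0 < C" "0 < \<theta>" "\<theta> < 1" "0 < V" "0 < q" "q < 1" "3 \<le> B"
    "\<And>N M. 1 \<le> N \<Longrightarrow> 1 \<le> M \<Longrightarrow>
       \<bar>lyapunov_exponent A w - lyapunov_approx A w N M\<bar> \<le> C * \<theta> ^ (N - 1) + V * q ^ M * B ^ Suc N"
proof -
  obtain l C \<theta> where C: "0 < C" "0 < \<theta>" "\<theta> < 1"
    "\<And>n. \<bar>mean_incr A w n 1 1 - l\<bar> \<le> C * \<theta> ^ n"
    by (rule mean_incr_converges) (rule that; assumption)
  have l: "lyapunov_exponent A w = l"
    by (rule lyapunov_exponent_eqI[OF mean_log_average[OF C(4,2,3)]])
  obtain V q B :: real where V: "0 < V" "0 < q" "q < 1" "3 \<le> B"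
    "\<And>M n x. 1 \<le> M \<Longrightarrow> \<bar>x\<bar> < 1 \<Longrightarrow>
       \<bar>(\<Sum>k<M. truncated_iterate A w M n k * x ^ k) - \<Psi> n x\<bar> \<le> V * q ^ M * B ^ Suc n"
    by (rule truncation_error) (rule that; assumption)
  have error: "\<bar>lyapunov_exponent A w - lyapunov_approx A w N M\<bar> \<le> C * \<theta> ^ (N - 1) + V * q ^ M * B ^ Suc N"
    if N: "1 \<le> N" and M: "1 \<le> M" for N M
  proof -
    have it: "\<bar>truncated_iterate A w M n 0 - \<Psi> n 0\<bar> \<le> V * q ^ M * B ^ Suc n" for n
    proof -
      have "(\<Sum>k<M. truncated_iterate A w M n k * 0 ^ k) = truncated_iterate A w M n 0"
        using M by (cases M) (simp_all add: sum.lessThan_Suc_shift)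
      then show ?thesis using V(5)[OF M, of 0 n] by simp
    qed
    have geo: "(\<Sum>n<N. B ^ Suc n) \<le> B ^ Suc N"
    proof (induction N)
      case (Suc N)
      have "(\<Sum>n<Suc N. B ^ Suc n) \<le> 2 * B ^ Suc N" using Suc by simp
      also have "\<dots> \<le> B * B ^ Suc N" using V by (intro mult_right_mono) auto
      finally show ?case by simp
    qed (use V in simp)
    have "\<bar>lyapunov_approx A w N M - (\<Sum>n<N. \<Psi> n 0)\<bar>
        \<le> (\<Sum>n<N. \<bar>truncated_iterate A w M n 0 - \<Psi> n 0\<bar>)"
      unfolding lyapunov_approx_eq[OF M] sum_subtractf[symmetric] by (rule sum_abs)
    also have "\<dots> \<le> (\<Sum>n<N. V * q ^ M * B ^ Suc n)"
      by (intro sum_mono it)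
    also have "\<dots> = V * q ^ M * (\<Sum>n<N. B ^ Suc n)"
      by (simp only: sum_distrib_left)
    also have "\<dots> \<le> V * q ^ M * B ^ Suc N"
      using V geo by (intro mult_left_mono) auto
    finally have "\<bar>lyapunov_approx A w N M - (\<Sum>n<N. \<Psi> n 0)\<bar> \<le> V * q ^ M * B ^ Suc N" .
    moreover have "(\<Sum>n<N. \<Psi> n 0) = mean_incr A w (N - 1) 1 1"
      using sum_\<Psi>[of "N - 1"] N by (simp add: \<Phi>_at_0)
    ultimately show ?thesis
      using C(4)[of "N - 1"] l by linarith
  qed
  show ?thesis
    by (rule that[OF C(1-3) V(1-4) error])
qed

end

section \<open>Straight-line programs\<close>

lemma run_append:
  "run g rs (p @ q) = Option.bind (run g rs p) (\<lambda>rs'. run g rs' q)"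
proof (induction p arbitrary: rs)
  case (Cons c p)
  then show ?case
    by (cases "instruction_value g rs c") simp_all
qed simp

lemma run_length: "run g rs p = Some rs' \<Longrightarrow> length rs' = length rs + length p"
proof (induction p arbitrary: rs)
  case (Cons c p)
  then show ?case
    by (cases "instruction_value g rs c") auto
qed simp

lemma run_extends: "run g rs p = Some rs' \<Longrightarrow> \<exists>zs. rs' = rs @ zs"
proof (induction p arbitrary: rs)
  case (Cons c p)
  then show ?case
    by (cases "instruction_value g rs c") fastforce+
qed simp

lemma operand_value_append:
  "operand_value g rs a = Some x \<Longrightarrow> operand_value g (rs @ zs) a = Some x"
  by (cases a) (auto simp: nth_append split: if_splits)

type_synonym 'i quantity = "('i given \<Rightarrow> real) \<Rightarrow> real"

locale straight_line =
  fixes G :: "('i given \<Rightarrow> real) set"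
begin

text \<open>Quantities are computed uniformly over the valuations in $G$: the operand holding a quantity,
  and the instructions added, do not depend on the valuation.\<close>

definition available :: "'i program \<Rightarrow> 'i quantity set \<Rightarrow> bool" where
  "available p X \<longleftrightarrow> (\<forall>g\<in>G. run g [] p \<noteq> None) \<and>
     (\<forall>\<phi>\<in>X. \<exists>a. \<forall>g\<in>G. \<forall>rs. run g [] p = Some rs \<longrightarrow> operand_value g rs a = Some (\<phi> g))"

text \<open>Operands are absolute register numbers, so the appended instructions depend on what was
  run before. Quantifying over every program \<open>p\<close> makes derivations compose without
  renumbering.\<close>

definition derivable :: "'i quantity set \<Rightarrow> nat \<Rightarrow> 'i quantity set \<Rightarrow> bool" where
  "derivable X n Y \<longleftrightarrow>
     (\<forall>p. available p X \<longrightarrow> (\<exists>q. length q \<le> n \<and> available (p @ q) Y))"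

lemma available_subset: "available p X \<Longrightarrow> Y \<subseteq> X \<Longrightarrow> available p Y"
  by (auto simp: available_def)

lemma available_Un: "available p X \<Longrightarrow> available p Y \<Longrightarrow> available p (X \<union> Y)"
  by (auto simp: available_def)

text \<open>A run only appends to the register list, so old operands keep their values.\<close>

lemma available_append:
  assumes "available p X" "\<forall>g\<in>G. run g [] (p @ q) \<noteq> None"
  shows "available (p @ q) X"
  unfolding available_def
proof (intro conjI ballI)
  fix \<phi> assume "\<phi> \<in> X"
  then obtain a where a: "\<forall>g\<in>G. \<forall>rs. run g [] p = Some rs \<longrightarrow> operand_value g rs a = Some (\<phi> g)"
    using assms(1) unfolding available_def by blast
  have "operand_value g rs' a = Some (\<phi> g)" if g: "g \<in> G" and r: "run g [] (p @ q) = Some rs'" for g rs'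
  proof -
    obtain rs where rs: "run g [] p = Some rs" "run g rs q = Some rs'"
      using r by (cases "run g [] p") (auto simp: run_append)
    obtain zs where "rs' = rs @ zs" using run_extends[OF rs(2)] by blast
    then show ?thesis
      using a g rs(1) operand_value_append by blast
  qed
  then show "\<exists>a. \<forall>g\<in>G. \<forall>rs. run g [] (p @ q) = Some rs \<longrightarrow> operand_value g rs a = Some (\<phi> g)"
    by blast
qed (use assms(2) in blast)

lemma derivable_refl: "Y \<subseteq> X \<Longrightarrow> derivable X 0 Y"
  unfolding derivable_def by (auto intro: available_subset)

lemma derivable_mono:
  assumes "derivable X m Y" "X \<subseteq> X'" "m \<le> n" "Y' \<subseteq> Y"
  shows "derivable X' n Y'"
  using assms unfolding derivable_def by (meson available_subset order.trans)

lemma derivable_cong: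
  assumes "derivable X n {\<phi>}" "\<And>g. g \<in> G \<Longrightarrow> \<phi> g = \<psi> g"
  shows "derivable X n {\<psi>}"
  using assms unfolding derivable_def available_def by simp

lemma derivable_trans:
  assumes "derivable X m Y" "derivable (X \<union> Y) n Z"
  shows "derivable X (m + n) (Y \<union> Z)"
  unfolding derivable_def
proof (intro allI impI)
  fix p assume p: "available p X"
  obtain q where q: "length q \<le> m" "available (p @ q) Y"
    using assms(1) p unfolding derivable_def by blast
  have "available (p @ q) X"
    by (rule available_append[OF p]) (use q in \<open>simp add: available_def\<close>)
  then have "available (p @ q) (X \<union> Y)"
    using q by (intro available_Un)
  then obtain r where r: "length r \<le> n" "available ((p @ q) @ r) Z"
    using assms(2) unfolding derivable_def by blast
  have "available ((p @ q) @ r) Y"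
    by (rule available_append[OF q(2)]) (use r in \<open>simp add: available_def\<close>)
  then have "available ((p @ q) @ r) (Y \<union> Z)"
    using r by (intro available_Un)
  then show "\<exists>q. length q \<le> m + n \<and> available (p @ q) (Y \<union> Z)"
    using q r by (intro exI[of _ "q @ r"]) simp
qed

lemma derivable_then:
  assumes "derivable X m Y" "derivable (X \<union> Y) n Z"
  shows "derivable X (m + n) Z"
  by (rule derivable_mono[OF derivable_trans[OF assms]]) auto

lemma derivable_UN:
  assumes "finite I" "\<And>i. i \<in> I \<Longrightarrow> derivable X n (Y i)"
  shows "derivable X (card I * n) (\<Union>i\<in>I. Y i)"
  using assms
proof (induction I)
  case empty
  then show ?case by (simp add: derivable_refl)
next
  case (insert i I)
  have "derivable X (card I * n) (\<Union>i\<in>I. Y i)"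
    by (rule insert.IH) (use insert.prems in simp)
  then have "derivable (X \<union> Y i) (card I * n) (\<Union>i\<in>I. Y i)"
    by (rule derivable_mono) simp_all
  moreover have "derivable X n (Y i)"
    by (rule insert.prems) simp
  ultimately have "derivable X (n + card I * n) (Y i \<union> (\<Union>i\<in>I. Y i))"
    by (intro derivable_trans)
  then show ?case
    using insert.hyps by simp
qed

text \<open>Dynamic programming, used for the constants, the coefficient tables, the powers and the
  iterates.\<close>

lemma derivable_rec:
  assumes "\<And>k. k < K \<Longrightarrow> derivable (X \<union> (\<Union>j<k. Y j)) n (Y k)"
  shows "derivable X (K * n) (\<Union>k<K. Y k)"
  using assms
proof (induction K)
  case 0
  then show ?case by (simp add: derivable_refl)
next
  case (Suc K)
  have "derivable X (K * n + n) ((\<Union>k<K. Y k) \<union> Y K)"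
    using Suc by (intro derivable_trans) auto
  then show ?case by (simp add: lessThan_Suc Un_commute add.commute)
qed

lemma run_instruction:
  assumes "run g [] p = Some rs" "instruction_value g rs c = Some x"
  shows "run g [] (p @ [c]) = Some (rs @ [x])"
  using assms by (simp add: run_append)

lemma derivable_instruction:
  assumes "\<And>p. available p X \<Longrightarrow>
    \<exists>c. \<forall>g\<in>G. \<forall>rs. run g [] p = Some rs \<longrightarrow> instruction_value g rs c = Some (\<phi> g)"
  shows "derivable X 1 {\<phi>}"
  unfolding derivable_def
proof (intro allI impI)
  fix p assume p: "available p X"
  then obtain c where c: "\<forall>g\<in>G. \<forall>rs. run g [] p = Some rs \<longrightarrow> instruction_value g rs c = Some (\<phi> g)"
    using assms by blast
  have run: "\<exists>rs. length rs = length p \<and> run g [] (p @ [c]) = Some (rs @ [\<phi> g])" if g: "g \<in> G" for g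
  proof -
    obtain rs where rs: "run g [] p = Some rs"
      using p g by (auto simp: available_def)
    then have "instruction_value g rs c = Some (\<phi> g)"
      using c g by blast
    from run_instruction[OF rs this] run_length[OF rs] show ?thesis
      by simp
  qed
  have "available (p @ [c]) {\<phi>}"
    unfolding available_def
  proof (intro conjI ballI)
    show "run g [] (p @ [c]) \<noteq> None" if "g \<in> G" for g
      using run[OF that] by auto
    show "\<exists>a. \<forall>g\<in>G. \<forall>rs. run g [] (p @ [c]) = Some rs \<longrightarrow> operand_value g rs a = Some (\<psi> g)"
      if "\<psi> \<in> {\<phi>}" for \<psi>
    proof (intro exI[of _ "Reg (length p)"] ballI allI impI)
      fix g rs assume "g \<in> G" "run g [] (p @ [c]) = Some rs"
      then show "operand_value g rs (Reg (length p)) = Some (\<psi> g)"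
        using run[of g] that by (auto simp: nth_append)
    qed
  qed
  then show "\<exists>q. length q \<le> 1 \<and> available (p @ q) {\<phi>}"
    by (intro exI[of _ "[c]"]) simp
qed

lemma available_operands:
  assumes "available p X" "\<phi> \<in> X" "\<psi> \<in> X"
  obtains a b where "\<And>g rs. g \<in> G \<Longrightarrow> run g [] p = Some rs \<Longrightarrow>
    operand_value g rs a = Some (\<phi> g) \<and> operand_value g rs b = Some (\<psi> g)"
proof -
  obtain a where "\<forall>g\<in>G. \<forall>rs. run g [] p = Some rs \<longrightarrow> operand_value g rs a = Some (\<phi> g)"
    using assms unfolding available_def by blast
  moreover obtain b where "\<forall>g\<in>G. \<forall>rs. run g [] p = Some rs \<longrightarrow> operand_value g rs b = Some (\<psi> g)"
    using assms unfolding available_def by blast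
  ultimately show ?thesis
    by (intro that[of a b]) simp
qed

lemma derivable_add:
  assumes "\<phi> \<in> X" "\<psi> \<in> X" shows "derivable X 1 {\<lambda>g. \<phi> g + \<psi> g}"
proof (rule derivable_instruction)
  fix p assume p: "available p X"
  obtain a b where "\<And>g rs. g \<in> G \<Longrightarrow> run g [] p = Some rs \<Longrightarrow>
    operand_value g rs a = Some (\<phi> g) \<and> operand_value g rs b = Some (\<psi> g)"
    by (rule available_operands[OF p assms]) (rule that; assumption)
  then show "\<exists>c. \<forall>g\<in>G. \<forall>rs. run g [] p = Some rs \<longrightarrow> instruction_value g rs c = Some (\<phi> g + \<psi> g)"
    by (intro exI[of _ "Add a b"]) simp
qed

lemma derivable_sub:
  assumes "\<phi> \<in> X" "\<psi> \<in> X" shows "derivable X 1 {\<lambda>g. \<phi> g - \<psi> g}"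
proof (rule derivable_instruction)
  fix p assume p: "available p X"
  obtain a b where "\<And>g rs. g \<in> G \<Longrightarrow> run g [] p = Some rs \<Longrightarrow>
    operand_value g rs a = Some (\<phi> g) \<and> operand_value g rs b = Some (\<psi> g)"
    by (rule available_operands[OF p assms]) (rule that; assumption)
  then show "\<exists>c. \<forall>g\<in>G. \<forall>rs. run g [] p = Some rs \<longrightarrow> instruction_value g rs c = Some (\<phi> g - \<psi> g)"
    by (intro exI[of _ "Sub a b"]) simp
qed

lemma derivable_mult:
  assumes "\<phi> \<in> X" "\<psi> \<in> X" shows "derivable X 1 {\<lambda>g. \<phi> g * \<psi> g}"
proof (rule derivable_instruction)
  fix p assume p: "available p X"
  obtain a b where "\<And>g rs. g \<in> G \<Longrightarrow> run g [] p = Some rs \<Longrightarrow>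
    operand_value g rs a = Some (\<phi> g) \<and> operand_value g rs b = Some (\<psi> g)"
    by (rule available_operands[OF p assms]) (rule that; assumption)
  then show "\<exists>c. \<forall>g\<in>G. \<forall>rs. run g [] p = Some rs \<longrightarrow> instruction_value g rs c = Some (\<phi> g * \<psi> g)"
    by (intro exI[of _ "Mul a b"]) simp
qed

lemma derivable_divide:
  assumes "\<phi> \<in> X" "\<psi> \<in> X" "\<And>g. g \<in> G \<Longrightarrow> \<psi> g \<noteq> 0"
  shows "derivable X 1 {\<lambda>g. \<phi> g / \<psi> g}"
proof (rule derivable_instruction)
  fix p assume p: "available p X"
  obtain a b where "\<And>g rs. g \<in> G \<Longrightarrow> run g [] p = Some rs \<Longrightarrow>
    operand_value g rs a = Some (\<phi> g) \<and> operand_value g rs b = Some (\<psi> g)"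
    by (rule available_operands[OF p assms(1,2)]) (rule that; assumption)
  then show "\<exists>c. \<forall>g\<in>G. \<forall>rs. run g [] p = Some rs \<longrightarrow> instruction_value g rs c = Some (\<phi> g / \<psi> g)"
    using assms(3) by (intro exI[of _ "Div a b"]) simp
qed

lemma derivable_sum:
  assumes "finite I" "\<And>i. i \<in> I \<Longrightarrow> f i \<in> X" "(\<lambda>g. 0) \<in> X"
  shows "derivable X (card I) {\<lambda>g. \<Sum>i\<in>I. f i g}"
  using assms
proof (induction I)
  case empty
  then show ?case by (simp add: derivable_refl)
next
  case (insert i I)
  have "derivable X (card I + 1) {\<lambda>g. f i g + (\<Sum>i\<in>I. f i g)}"
    using insert by (intro derivable_then[OF insert.IH] derivable_add) auto
  then show ?case using insert by simp
qed

lemma derivable_dot: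
  assumes "finite I" "\<And>i. i \<in> I \<Longrightarrow> f i \<in> X" "\<And>i. i \<in> I \<Longrightarrow> h i \<in> X" "(\<lambda>g. 0) \<in> X"
  shows "derivable X (2 * card I) {\<lambda>g. \<Sum>i\<in>I. f i g * h i g}"
proof -
  have products: "derivable X (card I * 1) (\<Union>i\<in>I. {\<lambda>g. f i g * h i g})"
    using assms by (intro derivable_UN derivable_mult)
  have "derivable X (card I * 1 + card I) {\<lambda>g. \<Sum>i\<in>I. f i g * h i g}"
    by (rule derivable_then[OF products derivable_sum]) (use assms in auto)
  then show ?thesis by (simp add: mult_2)
qed

text \<open>The quantity may sit in an early register or be a given number, whereas the output is
  the last register. Adding zero copies it there, at the cost of one operation.\<close>

lemma computes_of_derivable:
  assumes "derivable (range (\<lambda>a g. g a)) n {\<phi>, \<lambda>g. 0}"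
  obtains p where "length p \<le> n + 1" "\<And>g. g \<in> G \<Longrightarrow> computes g p (\<phi> g)"
proof -
  have "\<exists>b. \<forall>g\<in>G. \<forall>rs. run g [] [] = Some rs \<longrightarrow> operand_value g rs b = Some (g a)" for a
    by (intro exI[of _ "Given a"]) simp
  then have "available [] (range (\<lambda>a g. g a))"
    by (auto simp: available_def)
  then obtain p where p: "length p \<le> n" "available p {\<phi>, \<lambda>g. 0}"
    using assms unfolding derivable_def by fastforce
  have "\<phi> \<in> {\<phi>, \<lambda>g. 0}" "(\<lambda>g. 0) \<in> {\<phi>, \<lambda>g. 0}"
    by simp_all
  note operands = available_operands[OF p(2) this]
  obtain a b where ab: "\<And>g rs. g \<in> G \<Longrightarrow> run g [] p = Some rs \<Longrightarrow>
    operand_value g rs a = Some (\<phi> g) \<and> operand_value g rs b = Some 0"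
    by (rule operands) (rule that; assumption)
  show ?thesis
  proof (rule that[of "p @ [Add a b]"])
    fix g assume g: "g \<in> G"
    obtain rs where rs: "run g [] p = Some rs"
      using p g by (auto simp: available_def)
    then have "run g [] (p @ [Add a b]) = Some (rs @ [\<phi> g])"
      using ab[OF g rs] by (intro run_instruction) simp_all
    then show "computes g (p @ [Add a b]) (\<phi> g)"
      by (simp add: computes_def)
  qed (use p in simp)
qed

end

section \<open>Entries and iterates as functions of the given numbers\<close>

definition coeff_quantity :: "'i \<Rightarrow> nat \<Rightarrow> nat \<Rightarrow> 'i quantity" where
  "coeff_quantity i n k g = moebius_coeff (g (F_transpose_0 i)) (g (F_0 i)) (g (F_deriv_0 i)) n k"

definition T_quantity :: "nat \<Rightarrow> nat \<Rightarrow> 'i::finite quantity" where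
  "T_quantity k n g = (if n = 0 then 0 else \<Sum>i\<in>UNIV. g (Weight i) * coeff_quantity i n k g)"

text \<open>Signs appear as subtractions from 0, the form in which a program can produce
  them.\<close>

definition v_quantity :: "nat \<Rightarrow> 'i::finite quantity" where
  "v_quantity k g =
     (if k = 0 then g V_0 else \<Sum>i\<in>UNIV. g (Weight i) * (0 - (0 - g (F_0 i)) ^ k / real k))"

primrec iterate_quantity :: "nat \<Rightarrow> nat \<Rightarrow> nat \<Rightarrow> 'i::finite quantity" where
  "iterate_quantity M 0 k g = v_quantity k g"
| "iterate_quantity M (Suc n) k g = (\<Sum>m<M. T_quantity k m g * iterate_quantity M n m g)"

lemma iterate_quantity_given_value:
  "iterate_quantity M n k (given_value A w) = truncated_iterate A w M n k"
proof (induction n arbitrary: k)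
  case 0
  then show ?case by (simp add: v_quantity_def v_vec_def v_seq_def)
next
  case (Suc n)
  then show ?case by (simp add: T_quantity_def T_entry_eq coeff_quantity_def cong: if_cong)
qed

text \<open>On these valuations a weight can safely be divided by itself, which is how the constant
  1 is obtained.\<close>

definition nonzero_weights :: "('i given \<Rightarrow> real) set" where
  "nonzero_weights = {g. \<forall>i. g (Weight i) \<noteq> 0}"

interpretation straight_line nonzero_weights .

abbreviation given_quantities :: "'i quantity set" where
  "given_quantities \<equiv> range (\<lambda>a g. g a)"

section \<open>Operation counts of the stages\<close>

definition constants :: "nat \<Rightarrow> 'i quantity set" where
  "constants M = insert (\<lambda>g. 0) ((\<lambda>k g. real k) ` {1..M})"

lemma given_quantities_memI: "(\<lambda>g. g a) \<in> given_quantities"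
  by blast

text \<open>Zero is a weight minus itself, one is a weight divided by itself, and the remaining
  integers follow by adding 1.\<close>

lemma derivable_constants:
  "derivable given_quantities (M + 1) (constants M :: 'i::finite quantity set)"
proof -
  let ?X = "given_quantities :: 'i quantity set"
  fix i :: 'i
  have "derivable ?X 1 {\<lambda>g. g (Weight i) - g (Weight i)}"
    by (intro derivable_sub given_quantities_memI)
  then have zero: "derivable ?X 1 {\<lambda>g. 0}"
    by simp
  let ?Y = "\<lambda>k. {\<lambda>g :: 'i given \<Rightarrow> real. real (Suc k)}"
  have "derivable (?X \<union> {\<lambda>g. 0}) (M * 1) (\<Union>k<M. ?Y k)"
  proof (rule derivable_rec)
    fix k
    show "derivable (?X \<union> {\<lambda>g. 0} \<union> (\<Union>j<k. ?Y j)) 1 (?Y k)"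
    proof (cases k)
      case 0
      have "derivable ?X 1 {\<lambda>g. g (Weight i) / g (Weight i)}"
        by (intro derivable_divide given_quantities_memI) (simp add: nonzero_weights_def)
      then have "derivable ?X 1 {\<lambda>g. 1}"
        by (rule derivable_cong) (simp add: nonzero_weights_def)
      then show ?thesis
        by (rule derivable_mono) (auto simp: 0)
    next
      case (Suc m)
      have "derivable (\<Union>j<k. ?Y j) 1 {\<lambda>g. real (Suc m) + real (Suc 0)}"
      proof (rule derivable_add)
        show "(\<lambda>g. real (Suc m)) \<in> (\<Union>j<k. ?Y j)"
          by (rule UN_I[of m]) (simp_all add: Suc)
        show "(\<lambda>g. real (Suc 0)) \<in> (\<Union>j<k. ?Y j)"
          by (rule UN_I[of 0]) (simp_all add: Suc)
      qed
      then show ?thesis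
        by (rule derivable_mono) (auto simp: Suc)
    qed
  qed
  then have "derivable ?X (1 + M * 1) ({\<lambda>g. 0} \<union> (\<Union>k<M. ?Y k))"
    by (intro derivable_trans zero)
  moreover have "(\<Union>k<M. ?Y k) = (\<lambda>k g. real k) ` {1..M}"
  proof -
    have "{1..M} = Suc ` {..<M}"
      by (simp add: image_Suc_lessThan)
    then show ?thesis
      by (simp only: image_image UNION_singleton_eq_range)
  qed
  ultimately show ?thesis by (simp add: constants_def)
qed

lemma zero_in_constants: "(\<lambda>g. 0) \<in> constants M"
  by (simp add: constants_def)

lemma nat_in_constants: "1 \<le> k \<Longrightarrow> k \<le> M \<Longrightarrow> (\<lambda>g. real k) \<in> constants M"
  by (auto simp: constants_def)

lemma one_in_constants: "1 \<le> M \<Longrightarrow> (\<lambda>g. 1) \<in> constants M"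
  using nat_in_constants[of 1 M] by simp

lemma derivable_coeff_step:
  assumes "(\<lambda>g. g (F_transpose_0 i)) \<in> X" "(\<lambda>g. g (F_0 i)) \<in> X"
    "(\<lambda>g. g (F_transpose_0 i) * g (F_0 i) + g (F_deriv_0 i)) \<in> X"
    "coeff_quantity i n (Suc k) \<in> X" "coeff_quantity i n k \<in> X" "coeff_quantity i (Suc n) k \<in> X"
  shows "derivable X 5 {coeff_quantity i (Suc n) (Suc k)}"
proof -
  let ?f = "\<lambda>g. g (F_transpose_0 i) * coeff_quantity i n (Suc k) g"
  let ?h = "\<lambda>g. (g (F_transpose_0 i) * g (F_0 i) + g (F_deriv_0 i)) * coeff_quantity i n k g"
  let ?l = "\<lambda>g. g (F_0 i) * coeff_quantity i (Suc n) k g"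
  have "derivable X (1 + 1) ({?f} \<union> {?h})"
    using assms by (intro derivable_trans derivable_mult) auto
  then have "derivable X (1 + 1 + 1) (({?f} \<union> {?h}) \<union> {?l})"
    using assms by (intro derivable_trans derivable_mult) auto
  then have "derivable X (1 + 1 + 1 + 1) ((({?f} \<union> {?h}) \<union> {?l}) \<union> {\<lambda>g. ?f g + ?h g})"
    by (rule derivable_trans) (intro derivable_add; simp)
  then have "derivable X (1 + 1 + 1 + 1 + 1) {\<lambda>g. (\<lambda>g. ?f g + ?h g) g - ?l g}"
    by (rule derivable_then) (intro derivable_sub; simp)
  from derivable_cong[OF this, of "coeff_quantity i (Suc n) (Suc k)"] show ?thesis
    by (simp add: coeff_quantity_def moebius_coeff_Suc eval_nat_numeral)
qed

text \<open>The summand 2 pays once for c b + t. With \<open>n\<close> in the outer loop and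
  \<open>k\<close> in the inner one, the three neighbours required by
  \<open>moebius_coeff_Suc\<close> are already in the table.\<close>

lemma derivable_coeffs:
  assumes "given_quantities \<subseteq> X" "constants M \<subseteq> X"
  shows "derivable X (2 + M * (M * 5)) (\<Union>n<M. \<Union>k<M. {coeff_quantity i n k})"
proof -
  let ?s = "\<lambda>g. g (F_transpose_0 i) * g (F_0 i) + g (F_deriv_0 i)"
  have mem: "(\<lambda>g. g a) \<in> X" for a
    using assms(1) by blast
  have "derivable X (1 + 1) {?s}"
    by (rule derivable_then[OF derivable_mult[of "\<lambda>g. g (F_transpose_0 i)" _ "\<lambda>g. g (F_0 i)"] derivable_add])
      (use mem in auto)
  moreover have "derivable (X \<union> {?s}) (M * (M * 5)) (\<Union>n<M. \<Union>k<M. {coeff_quantity i n k})"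
  proof (intro derivable_rec)
    fix n k assume nk: "n < M" "k < M"
    let ?old = "\<Union>n'<n. \<Union>k'<M. {coeff_quantity i n' k'}"
    let ?row = "\<Union>k'<k. {coeff_quantity i n k'}"
    let ?Z = "X \<union> {?s} \<union> ?old \<union> ?row"
    have given: "(\<lambda>g. g a) \<in> ?Z" for a
      using mem by simp
    have old: "coeff_quantity i n' k' \<in> ?Z" if "n' < n" "k' < M" for n' k'
      using that by (intro UnI1 UnI2) auto
    have row: "coeff_quantity i n k' \<in> ?Z" if "k' < k" for k'
      using that by (intro UnI2) auto
    show "derivable ?Z 5 {coeff_quantity i n k}"
    proof (cases n)
      case 0
      have "coeff_quantity i 0 k = (\<lambda>g. if k = 0 then 1 else 0)"
        by (simp add: coeff_quantity_def moebius_coeff_def fun_eq_iff)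
      also have "\<dots> \<in> X"
        using assms(2) zero_in_constants[of M] one_in_constants[of M] nk by auto
      finally have "derivable ?Z 0 {coeff_quantity i n k}"
        using 0 by (intro derivable_refl) simp
      then show ?thesis
        by (rule derivable_mono) simp_all
    next
      case n: (Suc m)
      show ?thesis
      proof (cases k)
        case 0
        have "derivable ?Z 1 {\<lambda>g. g (F_transpose_0 i) * coeff_quantity i m 0 g}"
          by (intro derivable_mult given old) (use n nk in auto)
        then have "derivable ?Z 1 {coeff_quantity i n k}"
          by (rule derivable_cong) (simp add: n 0 coeff_quantity_def moebius_coeff_def)
        then show ?thesis
          by (rule derivable_mono) simp_all
      next
        case k: (Suc j)
        have "coeff_quantity i m (Suc j) \<in> ?Z" "coeff_quantity i m j \<in> ?Z"
          "coeff_quantity i (Suc m) j \<in> ?Z"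
          using old[of m "Suc j"] old[of m j] row[of j] n k nk by simp_all
        then have "derivable ?Z 5 {coeff_quantity i (Suc m) (Suc j)}"
          by (intro derivable_coeff_step given) simp_all
        then show ?thesis
          by (simp only: n k)
      qed
    qed
  qed
  ultimately have "derivable X (1 + 1 + M * (M * 5)) (\<Union>n<M. \<Union>k<M. {coeff_quantity i n k})"
    by (rule derivable_then)
  then show ?thesis
    by (simp add: numeral_2_eq_2)
qed

lemma derivable_v_terms:
  assumes "given_quantities \<subseteq> X" "constants M \<subseteq> X"
  shows "derivable X (1 + M + M * 2) (\<Union>k<M. {\<lambda>g. 0 - (0 - g (F_0 i)) ^ k / real k})"
proof -
  let ?b = "\<lambda>g. 0 - g (F_0 i)"
  let ?P = "\<Union>k<M. {\<lambda>g. ?b g ^ k}"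
  have "derivable X 1 {?b}"
    using assms zero_in_constants[of M] by (intro derivable_sub) auto
  moreover have "derivable (X \<union> {?b}) (M * 1) ?P"
  proof (rule derivable_rec)
    fix k assume k: "k < M"
    show "derivable (X \<union> {?b} \<union> (\<Union>k<k. {\<lambda>g. ?b g ^ k})) 1 {\<lambda>g. ?b g ^ k}"
    proof (cases k)
      case 0
      then show ?thesis
        using assms one_in_constants[of M] k
        by (intro derivable_mono[OF derivable_refl, of "{\<lambda>g. ?b g ^ k}"]) auto
    next
      case (Suc m)
      have "derivable (X \<union> {?b} \<union> (\<Union>k<k. {\<lambda>g. ?b g ^ k})) 1 {\<lambda>g. ?b g * ?b g ^ m}"
        using Suc by (intro derivable_mult) auto
      then show ?thesis
        by (simp add: Suc)
    qed
  qed
  ultimately have P: "derivable X (1 + M * 1) ?P"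
    by (rule derivable_then)
  have "derivable (X \<union> ?P) (card {..<M} * 2) (\<Union>k<M. {\<lambda>g. 0 - ?b g ^ k / real k})"
  proof (rule derivable_UN)
    fix k assume k: "k \<in> {..<M}"
    show "derivable (X \<union> ?P) 2 {\<lambda>g. 0 - ?b g ^ k / real k}"
    proof (cases "k = 0")
      \<comment> \<open>For k = 0 the quotient is 1 / 0, which is 0 as a real term but makes a
        program fail; the quantity is taken as the constant 0 instead.\<close>
      case True
      have "derivable X 0 {\<lambda>g. 0}"
        using assms zero_in_constants[of M] by (intro derivable_refl) auto
      then have "derivable (X \<union> ?P) 2 {\<lambda>g. 0}"
        by (rule derivable_mono) simp_all
      then show ?thesis
        by (rule derivable_cong) (simp add: True)
    next
      case False
      have quotient: "derivable (X \<union> ?P) 1 {\<lambda>g. ?b g ^ k / real k}"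
        using False k assms nat_in_constants[of k M] by (intro derivable_divide) auto
      have "derivable (X \<union> ?P) (1 + 1) {\<lambda>g. 0 - ?b g ^ k / real k}"
        by (rule derivable_then[OF quotient derivable_sub]) (use assms zero_in_constants[of M] in auto)
      then show ?thesis by (simp only: one_add_one)
    qed
  qed simp
  from derivable_then[OF P this] show ?thesis by simp
qed

text \<open>The summands of the cost are, in order, those of the constants, the coefficients for
  each letter, the logarithm terms for each letter, the entries of \<open>T\<close>, the entries of
  \<open>v\<close>, the iterates and the final sum. Iterates come from matrix-vector products, so no
  matrix power is ever formed.\<close>

lemma derivable_approximation:
  assumes "1 \<le> M"
  shows "derivable given_quantities
    ((M + 1) + CARD('i) * (2 + M * (M * 5)) + CARD('i) * (1 + M + M * 2)
      + M * (M * (2 * CARD('i))) + M * (2 * CARD('i)) + N * (M * (2 * M)) + N)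
    {\<lambda>g :: 'i::finite given \<Rightarrow> real. \<Sum>n<N. iterate_quantity M n 0 g, \<lambda>g. 0}"
proof -
  let ?G = "given_quantities :: 'i quantity set"
  let ?K = "constants M :: 'i quantity set"
  let ?C = "\<Union>i. \<Union>n<M. \<Union>k<M. {coeff_quantity i n k} :: 'i quantity set"
  let ?V = "\<Union>i. \<Union>k<M. {\<lambda>g. 0 - (0 - g (F_0 i)) ^ k / real k} :: 'i quantity set"
  let ?T = "\<Union>k<M. \<Union>n<M. {T_quantity k n} :: 'i quantity set"
  let ?W = "\<Union>k<M. {v_quantity k} :: 'i quantity set"
  let ?I = "\<Union>n<N. \<Union>k<M. {iterate_quantity M n k} :: 'i quantity set"
  have 1: "derivable ?G (M + 1) ?K"
    by (rule derivable_constants)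
  have "derivable (?G \<union> ?K) (CARD('i) * (2 + M * (M * 5))) ?C"
    by (intro derivable_UN derivable_coeffs) auto
  note 2 = derivable_trans[OF 1 this]
  have "derivable (?G \<union> (?K \<union> ?C)) (CARD('i) * (1 + M + M * 2)) ?V"
    by (intro derivable_UN derivable_v_terms) auto
  note 3 = derivable_trans[OF 2 this]
  let ?X3 = "?G \<union> (?K \<union> ?C \<union> ?V)"
  have zeroK: "(\<lambda>g. 0) \<in> ?K"
    by (rule zero_in_constants)
  then have zero: "(\<lambda>g. 0) \<in> ?X3"
    by simp
  have given: "(\<lambda>g. g a) \<in> ?X3" for a by simp
  have "derivable ?X3 (card {..<M} * (card {..<M} * (2 * CARD('i)))) ?T"
  proof (intro derivable_UN)
    fix k n assume kn: "k \<in> {..<M}" "n \<in> {..<M}"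
    show "derivable ?X3 (2 * CARD('i)) {T_quantity k n}"
    proof (cases "n = 0")
      case True
      then have "T_quantity k n = (\<lambda>g :: 'i given \<Rightarrow> real. 0)" by (simp add: T_quantity_def fun_eq_iff)
      then show ?thesis
        using zero by (intro derivable_mono[OF derivable_refl, of "{T_quantity k n}" ?X3]) auto
    next
      case False
      then have "T_quantity k n = (\<lambda>g :: 'i given \<Rightarrow> real. \<Sum>i\<in>UNIV. g (Weight i) * coeff_quantity i n k g)"
        by (simp add: T_quantity_def fun_eq_iff)
      moreover have "coeff_quantity i n k \<in> ?X3" for i
        using kn by (intro UnI1 UnI2) auto
      ultimately show ?thesis
        using zero given by (simp only:) (intro derivable_dot; simp)
    qed
  qed auto
  note 4 = derivable_trans[OF 3 this]
  let ?X4 = "?G \<union> (?K \<union> ?C \<union> ?V \<union> ?T)"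
  have "derivable ?X4 (card {..<M} * (2 * CARD('i))) ?W"
  proof (rule derivable_UN)
    fix k assume k: "k \<in> {..<M}"
    show "derivable ?X4 (2 * CARD('i)) {v_quantity k}"
    proof (cases "k = 0")
      case True
      then have "v_quantity k = (\<lambda>g :: 'i given \<Rightarrow> real. g V_0)" by (simp add: v_quantity_def fun_eq_iff)
      then show ?thesis
        by (intro derivable_mono[OF derivable_refl, of "{v_quantity k}" ?X4]) auto
    next
      case False
      then have "v_quantity k = (\<lambda>g :: 'i given \<Rightarrow> real. \<Sum>i\<in>UNIV. g (Weight i) * (\<lambda>g. 0 - (0 - g (F_0 i)) ^ k / real k) g)"
        by (simp add: v_quantity_def fun_eq_iff)
      moreover have "(\<lambda>g. 0 - (0 - g (F_0 i)) ^ k / real k) \<in> ?X4" for i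
        using k by (intro UnI1 UnI2) auto
      moreover have "(\<lambda>g. g (Weight i)) \<in> ?X4" "(\<lambda>g. 0) \<in> ?X4" for i
        using zeroK by simp_all
      ultimately show ?thesis
        by (simp only:) (intro derivable_dot; simp only: finite)
    qed
  qed simp
  note 5 = derivable_trans[OF 4 this]
  let ?X5 = "?G \<union> (?K \<union> ?C \<union> ?V \<union> ?T \<union> ?W)"
  have "derivable ?X5 (N * (M * (2 * M))) ?I"
  proof (rule derivable_rec)
    fix n
    let ?Z = "?X5 \<union> (\<Union>n<n. \<Union>k<M. {iterate_quantity M n k})"
    have "derivable ?Z (card {..<M} * (2 * M)) (\<Union>k<M. {iterate_quantity M n k})"
    proof (rule derivable_UN)
      fix k assume k: "k \<in> {..<M}"
      show "derivable ?Z (2 * M) {iterate_quantity M n k}"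
      proof (cases n)
        case 0
        then have "iterate_quantity M n k = (v_quantity k :: 'i quantity)" by (simp add: fun_eq_iff)
        then show ?thesis
          using k by (intro derivable_mono[OF derivable_refl, of "{iterate_quantity M n k}" ?Z]) auto
      next
        case (Suc m)
        then have "iterate_quantity M n k =
            (\<lambda>g :: 'i given \<Rightarrow> real. \<Sum>j\<in>{..<M}. T_quantity k j g * iterate_quantity M m j g)"
          by (simp add: fun_eq_iff)
        moreover have "derivable ?Z (2 * card {..<M})
            {\<lambda>g. \<Sum>j\<in>{..<M}. T_quantity k j g * iterate_quantity M m j g}"
        proof (rule derivable_dot)
          show "T_quantity k j \<in> ?Z" if "j \<in> {..<M}" for j
            using that k by (intro UnI1 UnI2) auto
          show "iterate_quantity M m j \<in> ?Z" if "j \<in> {..<M}" for j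
            using that Suc by (intro UnI2) auto
          show "(\<lambda>g. 0) \<in> ?Z" using zeroK by simp
        qed simp
        ultimately show ?thesis by simp
      qed
    qed simp
    then show "derivable ?Z (M * (2 * M)) (\<Union>k<M. {iterate_quantity M n k})"
      by simp
  qed
  note 6 = derivable_trans[OF 5 this]
  let ?X6 = "?G \<union> (?K \<union> ?C \<union> ?V \<union> ?T \<union> ?W \<union> ?I)"
  have "derivable ?X6 (card {..<N}) {\<lambda>g. \<Sum>n\<in>{..<N}. iterate_quantity M n 0 g}"
  proof (rule derivable_sum)
    show "iterate_quantity M n 0 \<in> ?X6" if "n \<in> {..<N}" for n
      by (intro UnI2 UN_I[of n] UN_I[of "0::nat"]) (use that assms in simp_all)
    show "(\<lambda>g. 0) \<in> ?X6" using zeroK by simp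
  qed simp
  from derivable_trans[OF 6 this] show ?thesis
    by (rule derivable_mono) (use zeroK in auto)
qed

section \<open>The approximation theorem\<close>

text \<open>The program depends on \<open>N\<close> and \<open>M\<close> alone and thus precedes the
  choice of the family. A cubic bound in \<open>N + M\<close> suffices, since both will be of order
  ln(1/\<epsilon>).\<close>

lemma approximation_program:
  obtains prog :: "nat \<Rightarrow> nat \<Rightarrow> 'i::finite program" and K :: nat where
    "\<And>N M. 1 \<le> N \<Longrightarrow> 1 \<le> M \<Longrightarrow> operation_count (prog N M) \<le> K * (N + M) ^ 3"
    "\<And>N M A w. 1 \<le> N \<Longrightarrow> 1 \<le> M \<Longrightarrow> \<forall>i. 0 < w i \<Longrightarrow>
       computes (given_value A w) (prog N M) (lyapunov_approx A w N M)"
proof -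
  let ?c = "CARD('i)"
  have "\<exists>p :: 'i program. 1 \<le> N \<longrightarrow> 1 \<le> M \<longrightarrow> length p \<le> (6 + 15 * ?c) * (N + M) ^ 3 \<and>
      (\<forall>A w. (\<forall>i. 0 < w i) \<longrightarrow> computes (given_value A w) p (lyapunov_approx A w N M))" for N M
  proof (cases "1 \<le> N \<and> 1 \<le> M")
    case True
    then have M: "1 \<le> M" and N: "1 \<le> N" by simp_all
    let ?n = "(M + 1) + ?c * (2 + M * (M * 5)) + ?c * (1 + M + M * 2)
      + M * (M * (2 * ?c)) + M * (2 * ?c) + N * (M * (2 * M)) + N"
    obtain p :: "'i program" where p: "length p \<le> ?n + 1"
      "\<And>g. g \<in> nonzero_weights \<Longrightarrow> computes g p (\<Sum>n<N. iterate_quantity M n 0 g)"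
      by (rule computes_of_derivable[OF derivable_approximation[OF M, of N]]) (rule that; assumption)
    define S where "S = (N + M) ^ 3"
    have S: "N \<le> S" "1 \<le> S" "M \<le> S" "M * M \<le> S" "N * (M * M) \<le> S"
    proof -
      have S': "S = (N + M) * ((N + M) * (N + M))"
        by (simp add: S_def power3_eq_cube)
      show "N * (M * M) \<le> S" unfolding S' by (intro mult_mono) simp_all
      have "1 * (M * M) \<le> S" unfolding S' using N by (intro mult_mono) simp_all
      then show "M * M \<le> S" by simp
      have "1 * (M * 1) \<le> S" unfolding S' using N M by (intro mult_mono) simp_all
      then show "M \<le> S" by simp
      have "N * (1 * 1) \<le> S" unfolding S' using N M by (intro mult_mono) simp_all
      then show "N \<le> S" by simp
      then show "1 \<le> S" using N by simp
    qed
    \<comment> \<open>Every monomial is at most \<open>S\<close>, so the coefficients simply add up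
      to 6 and 15.\<close>
    have "?n + 1 = (M + 2 + N + 2 * (N * (M * M))) + ?c * (3 + 5 * M + 7 * (M * M))"
      by (simp add: algebra_simps)
    also have "\<dots> \<le> (S + 2 * S + S + 2 * S) + ?c * (3 * S + 5 * S + 7 * S)"
      using S by (intro add_mono mult_le_mono) simp_all
    also have "\<dots> = (6 + 15 * ?c) * S"
      by (simp add: algebra_simps)
    finally have "length p \<le> (6 + 15 * ?c) * (N + M) ^ 3"
      using p(1) by (simp add: S_def)
    moreover have "computes (given_value A w) p (lyapunov_approx A w N M)" if "\<forall>i. 0 < w i" for A w
    proof -
      have "given_value A w \<in> nonzero_weights"
        using that by (simp add: nonzero_weights_def less_imp_neq[symmetric])
      from p(2)[OF this] show ?thesis
        by (simp add: iterate_quantity_given_value lyapunov_approx_eq[OF M])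
    qed
    ultimately show ?thesis by blast
  qed auto
  then obtain prog :: "nat \<Rightarrow> nat \<Rightarrow> 'i program" where
    prog: "\<And>N M. 1 \<le> N \<longrightarrow> 1 \<le> M \<longrightarrow> length (prog N M) \<le> (6 + 15 * ?c) * (N + M) ^ 3 \<and>
      (\<forall>A w. (\<forall>i. 0 < w i) \<longrightarrow> computes (given_value A w) (prog N M) (lyapunov_approx A w N M))"
    by metis
  show ?thesis
    by (rule that[of prog "6 + 15 * ?c"]) (use prog in \<open>simp_all add: operation_count_def\<close>)
qed

text \<open>The inequality is solved for n by taking logarithms; the summand 1 makes it strict. The
  absolute value and the maximum keep the numerator nonnegative for all \<epsilon> when D is
  nonnegative. D absorbs a factor such as a power of B.\<close>

lemma geometric_below:
  fixes C r D \<epsilon> :: real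
  assumes "0 < C" "0 < r" "r < 1" "0 < \<epsilon>"
    and "(\<bar>ln (2 * C)\<bar> + max 0 (ln (1 / \<epsilon>)) + 1 + D) / ln (1 / r) \<le> real n"
  shows "C * r ^ n * exp D < \<epsilon> / 2"
proof -
  have "0 < ln (1 / r)" using assms by (simp add: ln_div)
  then have "\<bar>ln (2 * C)\<bar> + max 0 (ln (1 / \<epsilon>)) + 1 + D \<le> real n * ln (1 / r)"
    using assms(5) by (simp add: divide_le_eq)
  moreover have "ln (1 / r) = - ln r" "ln (1 / \<epsilon>) = - ln \<epsilon>" "ln (2 * C) = ln 2 + ln C"
    using assms by (simp_all add: ln_div ln_mult)
  ultimately have "ln C + real n * ln r + D < ln \<epsilon> - ln 2"
    by simp
  also have "\<dots> = ln (\<epsilon> / 2)"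
    using assms by (simp add: ln_div)
  finally have "exp (ln C + real n * ln r + D) < exp (ln (\<epsilon> / 2))"
    by simp
  moreover have "exp (real n * ln r) = r ^ n"
    using assms by (simp add: exp_of_nat_mult)
  ultimately show ?thesis
    using assms by (simp add: exp_add)
qed

lemma nat_ceiling_le: "0 \<le> x \<Longrightarrow> real (nat \<lceil>x\<rceil>) \<le> x + 1"
  by linarith

theorem theorem1p2:
  "\<exists>prog :: nat \<Rightarrow> nat \<Rightarrow> ('i::finite) program.
     \<forall>(A :: 'i \<Rightarrow> real^2^2) (w :: 'i \<Rightarrow> real).
       (\<forall>i. positive_matrix (A i) \<and> invertible (A i)) \<longrightarrow>
       (\<forall>i. 0 < w i) \<longrightarrow> (\<Sum>i\<in>UNIV. w i) = 1 \<longrightarrow>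
       (\<exists>(N :: real \<Rightarrow> nat) (M :: real \<Rightarrow> nat).
          (\<lambda>\<epsilon>. real (N \<epsilon>)) \<in> O[at_right 0](\<lambda>\<epsilon>. ln (1 / \<epsilon>)) \<and>
          (\<lambda>\<epsilon>. real (M \<epsilon>)) \<in> O[at_right 0](\<lambda>\<epsilon>. ln (real (N \<epsilon>) / \<epsilon>)) \<and>
          (\<forall>\<epsilon>>0. 1 \<le> N \<epsilon> \<and> 1 \<le> M \<epsilon> \<and>
             \<bar>lyapunov_exponent A w - lyapunov_approx A w (N \<epsilon>) (M \<epsilon>)\<bar> < \<epsilon>) \<and>
          (\<forall>\<epsilon>>0. \<exists>y. computes (given_value A w) (prog (N \<epsilon>) (M \<epsilon>)) y \<and>
             \<bar>lyapunov_exponent A w - y\<bar> < \<epsilon>) \<and>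
          (\<lambda>\<epsilon>. real (operation_count (prog (N \<epsilon>) (M \<epsilon>)))) \<in> O[at_right 0](\<lambda>\<epsilon>. ln (1 / \<epsilon>) ^ 3))"
proof -
  obtain prog :: "nat \<Rightarrow> nat \<Rightarrow> 'i program" and K :: nat where
    count: "\<And>N M. 1 \<le> N \<Longrightarrow> 1 \<le> M \<Longrightarrow> operation_count (prog N M) \<le> K * (N + M) ^ 3" and
    computes: "\<And>N M A w. 1 \<le> N \<Longrightarrow> 1 \<le> M \<Longrightarrow> \<forall>i. 0 < w i \<Longrightarrow>
       computes (given_value A w) (prog N M) (lyapunov_approx A w N M)"
    by (rule approximation_program[where 'i = 'i]) (rule that; assumption)
  show ?thesis
  proof (intro exI[of _ prog] allI impI)
    fix A :: "'i \<Rightarrow> real^2^2" and w :: "'i \<Rightarrow> real"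
    assume A: "\<forall>i. positive_matrix (A i) \<and> invertible (A i)" and w: "\<forall>i. 0 < w i" "(\<Sum>i\<in>UNIV. w i) = 1"
    interpret positive_invertible_family A w
      using A w by unfold_locales auto
    obtain C \<theta> V q B :: real where c: "0 < C" "0 < \<theta>" "\<theta> < 1" "0 < V" "0 < q" "q < 1" "3 \<le> B" and
      error: "\<And>N M. 1 \<le> N \<Longrightarrow> 1 \<le> M \<Longrightarrow>
       \<bar>lyapunov_exponent A w - lyapunov_approx A w N M\<bar> \<le> C * \<theta> ^ (N - 1) + V * q ^ M * B ^ Suc N"
      by (rule lyapunov_approx_error) (rule that; assumption)
    \<comment> \<open>The error bound is claimed for every positive \<epsilon>, also where the
      logarithm is negative.\<close>
    define L where "L \<epsilon> = max 0 (ln (1 / \<epsilon>))" for \<epsilon> :: real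
    define x where "x \<epsilon> = (\<bar>ln (2 * C)\<bar> + L \<epsilon> + 1 + 0) / ln (1 / \<theta>)" for \<epsilon>
    \<comment> \<open>The added 1 yields both \<open>1 \<le> N \<epsilon>\<close> and
      \<open>x \<epsilon> \<le> N \<epsilon> - 1\<close>, matching the exponent N - 1 of
      \<open>\<theta>\<close>.\<close>
    define N where "N \<epsilon> = nat \<lceil>x \<epsilon>\<rceil> + 1" for \<epsilon>
    \<comment> \<open>The last summand pays for the factor \<open>B ^ Suc (N \<epsilon>)\<close> of
      the truncation error.\<close>
    define y where "y \<epsilon> = (\<bar>ln (2 * V)\<bar> + L \<epsilon> + 1 + real (Suc (N \<epsilon>)) * ln B) / ln (1 / q)" for \<epsilon>
    define M where "M \<epsilon> = nat \<lceil>y \<epsilon>\<rceil> + 1" for \<epsilon>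
    have ln_pos: "0 < ln (1 / \<theta>)" "0 < ln (1 / q)" "0 < ln B"
      using c by (simp_all add: ln_div)
    have L0: "0 \<le> L \<epsilon>" for \<epsilon> by (simp add: L_def)
    have xy0: "0 \<le> x \<epsilon>" "0 \<le> y \<epsilon>" for \<epsilon>
      using ln_pos L0[of \<epsilon>] by (auto simp: x_def y_def intro!: divide_nonneg_pos add_nonneg_nonneg)
    have N1: "1 \<le> N \<epsilon>" and M1: "1 \<le> M \<epsilon>" for \<epsilon>
      by (simp_all add: N_def M_def)
    have close: "\<bar>lyapunov_exponent A w - lyapunov_approx A w (N \<epsilon>) (M \<epsilon>)\<bar> < \<epsilon>" if "0 < \<epsilon>" for \<epsilon>
    proof -
      have "x \<epsilon> \<le> real (N \<epsilon> - 1)"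
        unfolding N_def by linarith
      then have "C * \<theta> ^ (N \<epsilon> - 1) * exp 0 < \<epsilon> / 2"
        unfolding x_def L_def by (rule geometric_below[OF c(1-3) that])
      moreover have "y \<epsilon> \<le> real (M \<epsilon>)"
        unfolding M_def by linarith
      then have "V * q ^ M \<epsilon> * exp (real (Suc (N \<epsilon>)) * ln B) < \<epsilon> / 2"
        unfolding y_def L_def by (rule geometric_below[OF c(4-6) that])
      moreover have "exp (real (Suc (N \<epsilon>)) * ln B) = B ^ Suc (N \<epsilon>)"
        using c by (simp only: exp_of_nat_mult exp_ln)
      ultimately show ?thesis
        using error[OF N1 M1, of \<epsilon> \<epsilon>] by simp
    qed
    define cN where "cN = (\<bar>ln (2 * C)\<bar> + 2) / ln (1 / \<theta>) + 2"
    define cM where "cM = (\<bar>ln (2 * V)\<bar> + 2 + (cN + 1) * ln B) / ln (1 / q) + 2"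
    \<comment> \<open>Below exp(-1) the logarithm exceeds 1, so additive constants are absorbed into
      multiples of \<open>L \<epsilon>\<close>.\<close>
    have small: "L \<epsilon> = ln (1 / \<epsilon>)" "1 \<le> L \<epsilon>" "real (N \<epsilon>) \<le> cN * L \<epsilon>" "real (M \<epsilon>) \<le> cM * L \<epsilon>"
      "ln (1 / \<epsilon>) \<le> ln (real (N \<epsilon>) / \<epsilon>)"
      if \<epsilon>: "\<epsilon> \<in> {0<..<exp (- 1)}" for \<epsilon>
    proof -
      have "ln \<epsilon> < ln (exp (- 1))"
        using \<epsilon> by (subst ln_less_cancel_iff) auto
      then have "1 < ln (1 / \<epsilon>)" using \<epsilon> by (simp add: ln_div)
      then show L: "L \<epsilon> = ln (1 / \<epsilon>)" "1 \<le> L \<epsilon>" by (simp_all add: L_def)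
      have "\<bar>ln (2 * C)\<bar> + L \<epsilon> + 1 + 0 \<le> (\<bar>ln (2 * C)\<bar> + 2) * L \<epsilon>"
        using mult_left_mono[OF L(2), of "\<bar>ln (2 * C)\<bar>"] L(2) by (simp add: distrib_right)
      then have "x \<epsilon> \<le> (\<bar>ln (2 * C)\<bar> + 2) * L \<epsilon> / ln (1 / \<theta>)"
        unfolding x_def using ln_pos by (intro divide_right_mono) auto
      then show N: "real (N \<epsilon>) \<le> cN * L \<epsilon>"
        using nat_ceiling_le[OF xy0(1)[of \<epsilon>]] L(2) by (simp add: N_def cN_def distrib_right)
      have "real (Suc (N \<epsilon>)) \<le> (cN + 1) * L \<epsilon>"
        using N L(2) by (simp add: distrib_right)
      then have "real (Suc (N \<epsilon>)) * ln B \<le> (cN + 1) * L \<epsilon> * ln B"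
        using ln_pos by (intro mult_right_mono) auto
      then have "\<bar>ln (2 * V)\<bar> + L \<epsilon> + 1 + real (Suc (N \<epsilon>)) * ln B
          \<le> (\<bar>ln (2 * V)\<bar> + 2 + (cN + 1) * ln B) * L \<epsilon>"
        using mult_left_mono[OF L(2), of "\<bar>ln (2 * V)\<bar>"] L(2) by (simp add: algebra_simps)
      then have "y \<epsilon> \<le> (\<bar>ln (2 * V)\<bar> + 2 + (cN + 1) * ln B) * L \<epsilon> / ln (1 / q)"
        unfolding y_def using ln_pos by (intro divide_right_mono) auto
      then show "real (M \<epsilon>) \<le> cM * L \<epsilon>"
        using nat_ceiling_le[OF xy0(2)[of \<epsilon>]] L(2) by (simp add: M_def cM_def distrib_right)
      have "1 / \<epsilon> \<le> real (N \<epsilon>) / \<epsilon>"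
        using N1[of \<epsilon>] \<epsilon> by (intro divide_right_mono) auto
      then show "ln (1 / \<epsilon>) \<le> ln (real (N \<epsilon>) / \<epsilon>)"
        using \<epsilon> by (intro ln_mono) auto
    qed
    have near: "eventually P (at_right 0)" if "\<And>\<epsilon>. \<epsilon> \<in> {0<..<exp (- 1)} \<Longrightarrow> P \<epsilon>" for P :: "real \<Rightarrow> bool"
      by (rule eventually_at_rightI[of 0 "exp (- 1)"]) (use that in auto)
    have "(\<lambda>\<epsilon>. real (N \<epsilon>)) \<in> O[at_right 0](\<lambda>\<epsilon>. ln (1 / \<epsilon>))"
    proof (intro bigoI[of _ cN] near)
      fix \<epsilon> :: real assume "\<epsilon> \<in> {0<..<exp (- 1)}"
      from small[OF this] show "norm (real (N \<epsilon>)) \<le> cN * norm (ln (1 / \<epsilon>))" by simp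
    qed
    \<comment> \<open>\<open>M\<close> is even of order ln(1/\<epsilon>), which is at most
      ln(N/\<epsilon>) because \<open>N\<close> is at least 1.\<close>
    moreover have "(\<lambda>\<epsilon>. real (M \<epsilon>)) \<in> O[at_right 0](\<lambda>\<epsilon>. ln (real (N \<epsilon>) / \<epsilon>))"
    proof (intro bigoI[of _ cM] near)
      fix \<epsilon> :: real assume "\<epsilon> \<in> {0<..<exp (- 1)}"
      note s = small[OF this]
      have "0 < cM * L \<epsilon>" using s(4) M1[of \<epsilon>] by linarith
      then have "0 < cM" using s(2) by (simp add: zero_less_mult_iff)
      then have "cM * L \<epsilon> \<le> cM * ln (real (N \<epsilon>) / \<epsilon>)"
        using s by (intro mult_left_mono) auto
      then show "norm (real (M \<epsilon>)) \<le> cM * norm (ln (real (N \<epsilon>) / \<epsilon>))"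
        using s by simp
    qed
    moreover have "(\<lambda>\<epsilon>. real (operation_count (prog (N \<epsilon>) (M \<epsilon>)))) \<in> O[at_right 0](\<lambda>\<epsilon>. ln (1 / \<epsilon>) ^ 3)"
    proof (intro bigoI[of _ "real K * (cN + cM) ^ 3"] near)
      fix \<epsilon> :: real assume "\<epsilon> \<in> {0<..<exp (- 1)}"
      note s = small[OF this]
      have "real (operation_count (prog (N \<epsilon>) (M \<epsilon>))) \<le> real (K * (N \<epsilon> + M \<epsilon>) ^ 3)"
        using count[OF N1 M1, of \<epsilon> \<epsilon>] by (simp only: of_nat_le_iff)
      also have "\<dots> = real K * (real (N \<epsilon>) + real (M \<epsilon>)) ^ 3"
        by simp
      also have "\<dots> \<le> real K * ((cN + cM) * L \<epsilon>) ^ 3"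
        using s by (intro mult_left_mono power_mono) (simp_all add: distrib_right)
      finally show "norm (real (operation_count (prog (N \<epsilon>) (M \<epsilon>))))
          \<le> real K * (cN + cM) ^ 3 * norm (ln (1 / \<epsilon>) ^ 3)"
        using s by (simp add: power_mult_distrib mult.assoc)
    qed
    moreover have "\<forall>\<epsilon>>0. \<exists>y. computes (given_value A w) (prog (N \<epsilon>) (M \<epsilon>)) y \<and>
             \<bar>lyapunov_exponent A w - y\<bar> < \<epsilon>"
      using close computes[OF N1 M1] w(1) by blast
    ultimately show "\<exists>(N :: real \<Rightarrow> nat) (M :: real \<Rightarrow> nat).
          (\<lambda>\<epsilon>. real (N \<epsilon>)) \<in> O[at_right 0](\<lambda>\<epsilon>. ln (1 / \<epsilon>)) \<and>
          (\<lambda>\<epsilon>. real (M \<epsilon>)) \<in> O[at_right 0](\<lambda>\<epsilon>. ln (real (N \<epsilon>) / \<epsilon>)) \<and>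
          (\<forall>\<epsilon>>0. 1 \<le> N \<epsilon> \<and> 1 \<le> M \<epsilon> \<and>
             \<bar>lyapunov_exponent A w - lyapunov_approx A w (N \<epsilon>) (M \<epsilon>)\<bar> < \<epsilon>) \<and>
          (\<forall>\<epsilon>>0. \<exists>y. computes (given_value A w) (prog (N \<epsilon>) (M \<epsilon>)) y \<and>
             \<bar>lyapunov_exponent A w - y\<bar> < \<epsilon>) \<and>
          (\<lambda>\<epsilon>. real (operation_count (prog (N \<epsilon>) (M \<epsilon>)))) \<in> O[at_right 0](\<lambda>\<epsilon>. ln (1 / \<epsilon>) ^ 3)"
      using close N1 M1 by (intro exI[of _ N] exI[of _ M]) simp
  qed
qed

end
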